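(* Let $n\ge 1$ be an integer, let $(a,b)\subset\mathbb{R}$ be an open interval and let $f:(a,b)\to\mathbb{R}$. Then $f$ is $n$-monotone if and only if for every real polynomial $q\in\mathbb{R}_{n-1}[x]$ and all pairwise distinct $x_0,x_1,\ldots,x_{2n-1}\in(a,b)$ one has $$[x_0,x_1,\ldots,x_{2n-1}]_{f q^2}\ge 0.$$
   Context: Matrices are ordered by the Loewner order: $A\le B$ iff $B-A$ is positive semidefinite. $f:(a,b)\to\mathbb{R}$ is $n$-monotone if for all $n\times n$ (complex) Hermitian matrices $A,B$ with $aI<A\le B<bI$ (i.e. $A\le B$ and all eigenvalues of $A,B$ lie in $(a,b)$) one has $f(A)\le f(B)$, where $f(A)$ is defined by the functional calculus. $\mathbb{R}_{m}[x]$ denotes the real polynomials of degree at most $m$. For pairwise distinct points $\lambda_0,\ldots,\lambda_m$ the divided difference of a function $g$ is $[\lambda_0,\ldots,\lambda_m]_g=\sum_{i=0}^{m}\frac{g(\lambda_i)}{\prod_{j\ne i}(\lambda_i-\lambda_j)}$. $fq^2$ is the pointwise product $x\mapsto f(x)q(x)^2$. *)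

theory Defs
  imports
    "Jordan_Normal_Form.Schur_Decomposition"
    "Jordan_Normal_Form.Spectral_Radius"
    "HOL-Analysis.Interval_Integral"
begin

definition hermitian_mat :: "nat \<Rightarrow> complex mat \<Rightarrow> bool" where
  "hermitian_mat n A \<longleftrightarrow> A \<in> carrier_mat n n \<and> mat_adjoint A = A"

definition unitary_mat :: "nat \<Rightarrow> complex mat \<Rightarrow> bool" where
  "unitary_mat n U \<longleftrightarrow>
     U \<in> carrier_mat n n \<and> mat_adjoint U * U = 1\<^sub>m n \<and> U * mat_adjoint U = 1\<^sub>m n"

(* The order on complex numbers is that of Complex_Order, in which 0 \<le> z means that z is
   real and nonnegative. *)
definition psd_mat :: "nat \<Rightarrow> complex mat \<Rightarrow> bool" where
  "psd_mat n A \<longleftrightarrow>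
     hermitian_mat n A \<and> (\<forall>v \<in> carrier_vec n. 0 \<le> (A *\<^sub>v v) \<bullet>c v)"

definition loewner_le :: "nat \<Rightarrow> complex mat \<Rightarrow> complex mat \<Rightarrow> bool" where
  "loewner_le n A B \<longleftrightarrow>
     A \<in> carrier_mat n n \<and> B \<in> carrier_mat n n \<and> psd_mat n (B - A)"

text \<open>The functional calculus is a relation first: \<open>B\<close> is obtained from a unitary
  diagonalization of \<open>A\<close> with real eigenvalues by applying \<open>f\<close> to them. By the spectral
  theorem such a diagonalization exists for every Hermitian \<open>A\<close>, and \<open>B\<close> does not depend
  on its choice (see below).\<close>

definition fun_calc_rel :: "nat \<Rightarrow> (real \<Rightarrow> real) \<Rightarrow> complex mat \<Rightarrow> complex mat \<Rightarrow> bool" where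
  "fun_calc_rel n f A B \<longleftrightarrow>
     (\<exists>U d. unitary_mat n U
        \<and> A = U * mat_diag n (\<lambda>i. complex_of_real (d i)) * mat_adjoint U
        \<and> B = U * mat_diag n (\<lambda>i. complex_of_real (f (d i))) * mat_adjoint U)"

definition fun_calc :: "nat \<Rightarrow> (real \<Rightarrow> real) \<Rightarrow> complex mat \<Rightarrow> complex mat" where
  "fun_calc n f A = (THE B. fun_calc_rel n f A B)"

lemma fun_calc_rel_unique:
  assumes "fun_calc_rel n f A B" "fun_calc_rel n f A C"
  shows "B = C"
proof -
  obtain U d where U: "unitary_mat n U"
    and AU: "A = U * mat_diag n (\<lambda>i. complex_of_real (d i)) * mat_adjoint U"
    and BU: "B = U * mat_diag n (\<lambda>i. complex_of_real (f (d i))) * mat_adjoint U"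
    using assms(1) unfolding fun_calc_rel_def by blast
  obtain V e where V: "unitary_mat n V"
    and AV: "A = V * mat_diag n (\<lambda>i. complex_of_real (e i)) * mat_adjoint V"
    and CV: "C = V * mat_diag n (\<lambda>i. complex_of_real (f (e i))) * mat_adjoint V"
    using assms(2) unfolding fun_calc_rel_def by blast
  define U' V' where "U' = mat_adjoint U" and "V' = mat_adjoint V"
  have cU: "U \<in> carrier_mat n n" and cV: "V \<in> carrier_mat n n"
    and UU: "U' * U = 1\<^sub>m n" "U * U' = 1\<^sub>m n" and VV: "V' * V = 1\<^sub>m n" "V * V' = 1\<^sub>m n"
    using U V by (auto simp: unitary_mat_def U'_def V'_def)
  have cU': "U' \<in> carrier_mat n n" and cV': "V' \<in> carrier_mat n n"
    using cU cV by (auto simp: U'_def V'_def mat_adjoint_def)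
  note car = cU cV cU' cV' mat_diag_dim
  define W where "W = V' * U"
  have cW: "W \<in> carrier_mat n n" using car by (simp add: W_def)
  have VW: "V * W = U" using car VV by (simp add: W_def assoc_mult_mat[symmetric, of _ n n _ n _ n])
  have WU: "W * U' = V'" using car UU by (simp add: W_def assoc_mult_mat[of _ n n _ n _ n])
  have key: "V' * (U * D * U') * U = W * D" "V' * (V * D * V') * U = D * W"
    if D: "D \<in> carrier_mat n n" for D
  proof -
    have "V' * (U * D * U') * U = (V' * U) * D * (U' * U)"
      using car D by (simp add: assoc_mult_mat[of _ n n _ n _ n])
    then show "V' * (U * D * U') * U = W * D" using cW D UU by (simp add: W_def)
    have "V' * (V * D * V') * U = (V' * V) * D * (V' * U)"
      using car D by (simp add: assoc_mult_mat[of _ n n _ n _ n])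
    then show "V' * (V * D * V') * U = D * W" using D VV by (simp add: W_def)
  qed
  have eq: "W * mat_diag n (\<lambda>i. complex_of_real (d i)) = mat_diag n (\<lambda>i. complex_of_real (e i)) * W"
    using key AU AV by (metis U'_def V'_def mat_diag_dim)
  have ent: "W $$ (i,j) * complex_of_real (d j) = complex_of_real (e i) * W $$ (i,j)"
    if "i < n" "j < n" for i j
    using arg_cong[OF eq, of "\<lambda>M. M $$ (i,j)"] that cW
    by (simp add: mat_diag_mult_left[of _ n n] mat_diag_mult_right[of _ n n])
  have eqf: "W * mat_diag n (\<lambda>i. complex_of_real (f (d i)))
           = mat_diag n (\<lambda>i. complex_of_real (f (e i))) * W" (is "W * ?D = ?E * W")
  proof (rule eq_matI)
    fix i j assume "i < dim_row (?E * W)" "j < dim_col (?E * W)"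
    then have ij: "i < n" "j < n" using cW by (auto simp: mat_diag_def)
    have "W $$ (i,j) * complex_of_real (f (d j)) = complex_of_real (f (e i)) * W $$ (i,j)"
      using ent[OF ij] by (cases "W $$ (i,j) = 0") (auto simp: mult.commute)
    then show "(W * ?D) $$ (i,j) = (?E * W) $$ (i,j)"
      using ij cW by (simp add: mat_diag_mult_left[of _ n n] mat_diag_mult_right[of _ n n])
  qed (use cW in \<open>auto simp: mat_diag_def\<close>)
  have "B = (V * W) * ?D * U'" using BU VW by (simp add: U'_def)
  also have "\<dots> = V * (W * ?D) * U'"
    using car cW by (simp add: assoc_mult_mat[of _ n n _ n _ n])
  also have "\<dots> = V * ?E * (W * U')"
    unfolding eqf using car cW mult_carrier_mat[OF mat_diag_dim cW]
    by (simp add: assoc_mult_mat[of V n n _ n U' n] assoc_mult_mat[of V n n ?E n "W * U'" n]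
        assoc_mult_mat[of ?E n n W n U' n])
  also have "\<dots> = C" using CV WU by (simp add: V'_def)
  finally show ?thesis .
qed

lemma fun_calc_eqI: "fun_calc_rel n f A B \<Longrightarrow> fun_calc n f A = B"
  unfolding fun_calc_def using fun_calc_rel_unique by blast

text \<open>The function \<open>f\<close> is total, but the values outside \<open>einterval a b\<close> (the set of the reals
  strictly between \<open>a\<close> and \<open>b\<close>) play no role, since the spectra are contained in this set.
  The endpoints may be infinite.\<close>

definition n_monotone :: "nat \<Rightarrow> ereal \<Rightarrow> ereal \<Rightarrow> (real \<Rightarrow> real) \<Rightarrow> bool" where
  "n_monotone n a b f \<longleftrightarrow>
     (\<forall>A B. hermitian_mat n A \<longrightarrow> hermitian_mat n B \<longrightarrow>
        spectrum A \<subseteq> complex_of_real ` einterval a b \<longrightarrow>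
        spectrum B \<subseteq> complex_of_real ` einterval a b \<longrightarrow>
        loewner_le n A B \<longrightarrow>
        loewner_le n (fun_calc n f A) (fun_calc n f B))"

text \<open>Divided difference of \<open>g\<close> at the points \<open>x 0, \<dots>, x m\<close>, meant for pairwise distinct points.\<close>

definition divided_difference :: "nat \<Rightarrow> (nat \<Rightarrow> real) \<Rightarrow> (real \<Rightarrow> real) \<Rightarrow> real" where
  "divided_difference m x g = (\<Sum>i\<le>m. g (x i) / (\<Prod>j\<in>{..m} - {i}. x i - x j))"

end

theory Submission
  imports Defs
begin

unbundle no vec_syntax and no inner_syntax

text \<open>Both directions rest on one computation. Suppose that \<open>B - A = v v\<^sup>*\<close> has rank one, that
  \<open>A\<close> has the eigenvalues \<open>l\<close> and that \<open>B\<close> has the eigenvalues \<open>u\<close>, interlacing and all distinct.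
  In an eigenbasis of \<open>A\<close> the eigenvectors of \<open>B\<close> form a Cauchy matrix, and Lagrange interpolation
  turns the quadratic form of \<open>f(B) - f(A)\<close> at a vector \<open>w\<close> into the divided difference of
  \<open>f q\<^sup>2\<close> at the \<open>2 n\<close> points \<open>l\<close>, \<open>u\<close>, where \<open>q\<close> is a polynomial of degree less than \<open>n\<close>
  determined by \<open>w\<close> (a complex \<open>w\<close> gives two such polynomials, for its real and imaginary parts).

  From monotonicity to divided differences (\<open>n_monotone_imp_square_positive\<close>): given \<open>2 n\<close> points,
  sort them, call them alternately \<open>l\<close> and \<open>u\<close>, and write down a rank-one perturbation with these
  eigenvalues; every \<open>q\<close> comes from some \<open>w\<close> (\<open>interlacing_rank_one\<close>).

  From divided differences to monotonicity (\<open>square_positive_imp_n_monotone\<close>): by the spectral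
  theorem a positive semidefinite \<open>B - A\<close> is a sum of rank-one terms, and the partial sums lead from
  \<open>A\<close> to \<open>B\<close> through matrices whose spectra stay in the interval. So one rank-one step is enough
  (\<open>rank_one_monotone\<close>). Here eigenvalues may be repeated or shared by \<open>A\<close> and \<open>B\<close>. The resolvents
  take care of this: \<open>(R\<^sub>B(t) w, w) - (R\<^sub>A(t) w, w)\<close>, where \<open>R\<^sub>A(t)\<close> is the inverse of \<open>A - t\<close>, is a
  rational function of \<open>t\<close>. Its numerator is minus a sum of two squares, and its denominator is a
  product over the \<open>2 k\<close> points that are left after cancellation, for some \<open>k \<le> n\<close>.
  Its residues give \<open>f(B) - f(A)\<close> as divided differences at these points (\<open>rank_one_weights_div_diff\<close>). Hence the hypothesis is needed for \<open>2 k\<close> points and polynomials of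
  degree less than \<open>k\<close>; it descends from \<open>n\<close> to \<open>k\<close> by adding two points that coalesce
  (\<open>square_positive_mono\<close>).\<close>

section \<open>Matrices given by a unitary diagonalization\<close>

lemma mat_adjoint_dim [simp]:
  "dim_row (mat_adjoint A) = dim_col A" "dim_col (mat_adjoint A) = dim_row A"
  by (simp_all add: mat_adjoint_def)

lemma mat_adjoint_carrier [simp]:
  "A \<in> carrier_mat n m \<Longrightarrow> mat_adjoint A \<in> carrier_mat m n"
  by auto

lemma mat_adjoint_index [simp]:
  fixes A :: "complex mat"
  assumes "i < dim_col A" "j < dim_row A"
  shows "mat_adjoint A $$ (i, j) = cnj (A $$ (j, i))"
  using assms by (simp add: mat_adjoint_def mat_of_rows_index)

lemma mat_adjoint_adjoint [simp]: "mat_adjoint (mat_adjoint A) = (A :: complex mat)"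
  by (rule eq_matI) auto

lemma mat_adjoint_mult:
  fixes A B :: "complex mat"
  assumes "A \<in> carrier_mat n m" "B \<in> carrier_mat m k"
  shows "mat_adjoint (A * B) = mat_adjoint B * mat_adjoint A"
  using assms by (intro eq_matI) (auto simp: scalar_prod_def mult.commute)

lemma mat_adjoint_one [simp]: "mat_adjoint (1\<^sub>m n :: complex mat) = 1\<^sub>m n"
  by (rule eq_matI) auto

lemma mat_adjoint_diag [simp]:
  "mat_adjoint (mat_diag n g) = mat_diag n (\<lambda>i. cnj (g i))"
  by (rule eq_matI) (auto simp: mat_diag_def)

lemma cscalar_prod_adjoint:
  fixes A :: "complex mat"
  assumes "A \<in> carrier_mat n m" "v \<in> carrier_vec m" "w \<in> carrier_vec n"
  shows "(A *\<^sub>v v) \<bullet>c w = v \<bullet>c (mat_adjoint A *\<^sub>v w)"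
proof -
  have "(A *\<^sub>v v) \<bullet>c w = (\<Sum>i<n. \<Sum>j<m. A $$ (i, j) * v $ j * cnj (w $ i))"
    using assms by (simp add: scalar_prod_def sum_distrib_right atLeast0LessThan)
  also have "\<dots> = (\<Sum>j<m. \<Sum>i<n. A $$ (i, j) * v $ j * cnj (w $ i))"
    by (rule sum.swap)
  also have "\<dots> = v \<bullet>c (mat_adjoint A *\<^sub>v w)"
    using assms by (simp add: scalar_prod_def sum_distrib_left atLeast0LessThan ac_simps)
  finally show ?thesis .
qed

definition spectral_mat :: "nat \<Rightarrow> complex mat \<Rightarrow> (nat \<Rightarrow> real) \<Rightarrow> complex mat" where
  "spectral_mat n U g = U * mat_diag n (\<lambda>i. complex_of_real (g i)) * mat_adjoint U"

lemma spectral_mat_carrier [simp]: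
  "U \<in> carrier_mat n n \<Longrightarrow> spectral_mat n U g \<in> carrier_mat n n"
  unfolding spectral_mat_def by (meson mat_adjoint_carrier mat_diag_dim mult_carrier_mat)

lemma spectral_mat_dim [simp]:
  "dim_row (spectral_mat n U g) = dim_row U" "dim_col (spectral_mat n U g) = dim_row U"
  by (simp_all add: spectral_mat_def)

lemma mat_diag_mult_vec_index:
  assumes "v \<in> carrier_vec n" "i < n"
  shows "(mat_diag n g *\<^sub>v v) $ i = g i * v $ i"
  using assms by (simp add: mat_diag_def scalar_prod_def atLeast0LessThan mult_delta_left)

lemma spectral_mat_index:
  assumes "U \<in> carrier_mat n n" "i < n" "j < n"
  shows "spectral_mat n U g $$ (i, j) = (\<Sum>k<n. U $$ (i, k) * of_real (g k) * cnj (U $$ (j, k)))"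
  using assms unfolding spectral_mat_def
  by (simp add: mat_diag_mult_right[of _ n n] scalar_prod_def atLeast0LessThan)

text \<open>The quadratic form in eigencoordinates. Everything that follows about \<open>f(A)\<close> is read off
  from this sum.\<close>
lemma spectral_mat_form:
  assumes U: "U \<in> carrier_mat n n" and v: "v \<in> carrier_vec n" and w: "w \<in> carrier_vec n"
  shows "(spectral_mat n U g *\<^sub>v v) \<bullet>c w
    = (\<Sum>i<n. of_real (g i) * (mat_adjoint U *\<^sub>v v) $ i * cnj ((mat_adjoint U *\<^sub>v w) $ i))"
proof -
  let ?D = "mat_diag n (\<lambda>i. complex_of_real (g i))"
  have "spectral_mat n U g *\<^sub>v v = U *\<^sub>v (?D *\<^sub>v (mat_adjoint U *\<^sub>v v))"
    using U v unfolding spectral_mat_def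
    by (simp add: assoc_mult_mat_vec[of _ n n _ n] mult_carrier_mat[of _ n n _ n]
        mult_mat_vec_carrier[of _ n n])
  then have "(spectral_mat n U g *\<^sub>v v) \<bullet>c w
      = (?D *\<^sub>v (mat_adjoint U *\<^sub>v v)) \<bullet>c (mat_adjoint U *\<^sub>v w)"
    using U v w by (simp add: cscalar_prod_adjoint[of _ n n] mult_mat_vec_carrier[of _ n n])
  also have "\<dots> = (\<Sum>i<n. (?D *\<^sub>v (mat_adjoint U *\<^sub>v v)) $ i * cnj ((mat_adjoint U *\<^sub>v w) $ i))"
    using U by (simp add: scalar_prod_def atLeast0LessThan)
  also have "\<dots> = (\<Sum>i<n. of_real (g i) * (mat_adjoint U *\<^sub>v v) $ i * cnj ((mat_adjoint U *\<^sub>v w) $ i))"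
    using mult_mat_vec_carrier[OF mat_adjoint_carrier[OF U] v]
    by (intro sum.cong refl) (simp add: mat_diag_mult_vec_index del: index_mult_mat_vec)
  finally show ?thesis .
qed

lemma unitary_matD:
  assumes "unitary_mat n U"
  shows "U \<in> carrier_mat n n" "mat_adjoint U \<in> carrier_mat n n"
    "mat_adjoint U * U = 1\<^sub>m n" "U * mat_adjoint U = 1\<^sub>m n"
  using assms by (auto simp: unitary_mat_def)

lemma unitary_matI:
  assumes "U \<in> carrier_mat n n" "mat_adjoint U * U = 1\<^sub>m n"
  shows "unitary_mat n U"
  using assms mat_mult_left_right_inverse[of "mat_adjoint U" n U] by (auto simp: unitary_mat_def)

lemma unitary_mat_mult_cancel:
  assumes "unitary_mat n U" "X \<in> carrier_mat n m"
  shows "mat_adjoint U * (U * X) = X" "U * (mat_adjoint U * X) = X"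
  using unitary_matD[OF assms(1)] assms(2)
  by (simp_all add: assoc_mult_mat[of _ n n _ n _ m, symmetric])

lemma unitary_mat_mult:
  assumes "unitary_mat n U" "unitary_mat n V"
  shows "unitary_mat n (U * V)"
proof (rule unitary_matI)
  note u = unitary_matD[OF assms(1)] and v = unitary_matD[OF assms(2)]
  show "U * V \<in> carrier_mat n n" using u v by simp
  show "mat_adjoint (U * V) * (U * V) = 1\<^sub>m n"
    using u v by (simp add: mat_adjoint_mult[of _ n n _ n] assoc_mult_mat[of _ n n _ n _ n]
        mult_carrier_mat[of _ n n _ n] unitary_mat_mult_cancel[OF assms(1), of _ n])
qed

lemma unitary_mat_mult_vec_cancel:
  assumes "unitary_mat n U" "v \<in> carrier_vec n"
  shows "U *\<^sub>v (mat_adjoint U *\<^sub>v v) = v" "mat_adjoint U *\<^sub>v (U *\<^sub>v v) = v"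
  using unitary_matD[OF assms(1)] assms(2)
  by (simp_all add: assoc_mult_mat_vec[of _ n n _ n, symmetric])

lemma spectral_mat_one: "unitary_mat n U \<Longrightarrow> spectral_mat n U (\<lambda>i. 1) = 1\<^sub>m n"
  using unitary_matD[of n U] by (simp add: spectral_mat_def)

lemma spectral_mat_mult:
  assumes "unitary_mat n U"
  shows "spectral_mat n U g * spectral_mat n U h = spectral_mat n U (\<lambda>i. g i * h i)"
proof -
  note u = unitary_matD[OF assms]
  let ?G = "mat_diag n (\<lambda>i. complex_of_real (g i))" and ?H = "mat_diag n (\<lambda>i. complex_of_real (h i))"
  have "spectral_mat n U g * spectral_mat n U h = U * (?G * ?H * mat_adjoint U)"
    using u unfolding spectral_mat_def
    by (simp add: assoc_mult_mat[of _ n n _ n _ n] mult_carrier_mat[of _ n n _ n]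
        unitary_mat_mult_cancel[OF assms, of _ n] del: mat_diag_diag)
  then show ?thesis
    using u by (simp add: spectral_mat_def assoc_mult_mat[of _ n n _ n _ n])
qed

lemma hermitian_spectral_mat:
  assumes "U \<in> carrier_mat n n"
  shows "hermitian_mat n (spectral_mat n U g)"
  using assms unfolding hermitian_mat_def spectral_mat_def
  by (auto simp: mat_adjoint_mult[of _ n n _ n] assoc_mult_mat[of _ n n _ n _ n]
      mult_carrier_mat[of _ n n _ n])

lemma fun_calc_spectral_mat:
  assumes "unitary_mat n U"
  shows "fun_calc n f (spectral_mat n U d) = spectral_mat n U (\<lambda>i. f (d i))"
  using assms by (intro fun_calc_eqI) (auto simp: fun_calc_rel_def spectral_mat_def)

lemma spectral_mat_mult_vec:
  assumes U: "unitary_mat n U" and v: "v \<in> carrier_vec n"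
  shows "mat_adjoint U *\<^sub>v (spectral_mat n U g *\<^sub>v v)
    = mat_diag n (\<lambda>i. of_real (g i)) *\<^sub>v (mat_adjoint U *\<^sub>v v)"
proof -
  note u = unitary_matD[OF U]
  let ?D = "mat_diag n (\<lambda>i. complex_of_real (g i))"
  have "spectral_mat n U g *\<^sub>v v = U *\<^sub>v (?D *\<^sub>v (mat_adjoint U *\<^sub>v v))"
    using u v unfolding spectral_mat_def
    by (simp add: assoc_mult_mat_vec[of _ n n _ n] mult_carrier_mat[of _ n n _ n]
        mult_mat_vec_carrier[of _ n n])
  then show ?thesis
    using unitary_mat_mult_vec_cancel(2)[OF U, of "?D *\<^sub>v (mat_adjoint U *\<^sub>v v)"] u v
    by (simp add: mult_mat_vec_carrier[of _ n n])
qed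

lemma spectrum_spectral_mat:
  assumes U: "unitary_mat n U"
  shows "spectrum (spectral_mat n U d) = complex_of_real ` d ` {..<n}"
proof (intro equalityI subsetI)
  note u = unitary_matD[OF U]
  have car: "spectral_mat n U d \<in> carrier_mat n n" using u by simp
  fix k assume "k \<in> spectrum (spectral_mat n U d)"
  then obtain v where v: "v \<in> carrier_vec n" "v \<noteq> 0\<^sub>v n"
      and eig: "spectral_mat n U d *\<^sub>v v = k \<cdot>\<^sub>v v"
    using car by (auto simp: spectrum_def eigenvalue_def eigenvector_def)
  define y where "y = mat_adjoint U *\<^sub>v v"
  have y: "y \<in> carrier_vec n" using mult_mat_vec_carrier[OF u(2) v(1)] by (simp add: y_def)
  have "y \<noteq> 0\<^sub>v n"
  proof
    assume "y = 0\<^sub>v n"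
    then have "U *\<^sub>v y = 0\<^sub>v n" using u by auto
    then show False using unitary_mat_mult_vec_cancel(1)[OF U v(1)] v y_def by simp
  qed
  then obtain i where i: "i < n" "y $ i \<noteq> 0" using y by (metis eq_vecI carrier_vecD index_zero_vec)
  have "mat_diag n (\<lambda>i. of_real (d i)) *\<^sub>v y = k \<cdot>\<^sub>v y"
    using spectral_mat_mult_vec[OF U v(1), of d] u v
    by (simp add: eig y_def mult_mat_vec[of _ n n])
  then have "of_real (d i) * y $ i = k * y $ i"
    using mat_diag_mult_vec_index[OF y i(1), of "\<lambda>i. of_real (d i)"] i y by simp
  then show "k \<in> complex_of_real ` d ` {..<n}" using i by auto
next
  note u = unitary_matD[OF U]
  have car: "spectral_mat n U d \<in> carrier_mat n n" using u by simp
  fix k assume "k \<in> complex_of_real ` d ` {..<n}"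
  then obtain i where i: "i < n" "k = of_real (d i)" by auto
  define v where "v = U *\<^sub>v unit_vec n i"
  have v: "v \<in> carrier_vec n" using u v_def by simp
  have uv: "mat_adjoint U *\<^sub>v v = unit_vec n i"
    unfolding v_def using unitary_mat_mult_vec_cancel(2)[OF U] by simp
  have "v \<noteq> 0\<^sub>v n"
  proof
    assume "v = 0\<^sub>v n"
    then have "mat_adjoint U *\<^sub>v v = 0\<^sub>v n" using u by auto
    then have "unit_vec n i $ i = (0\<^sub>v n $ i :: complex)" using uv by simp
    then show False using i by simp
  qed
  have sv: "spectral_mat n U d *\<^sub>v v \<in> carrier_vec n" using car v by (rule mult_mat_vec_carrier)
  have "mat_diag n (\<lambda>i. of_real (d i)) *\<^sub>v unit_vec n i = k \<cdot>\<^sub>v unit_vec n i"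
    using i by (intro eq_vecI) (auto simp: mat_diag_def)
  then have "mat_adjoint U *\<^sub>v (spectral_mat n U d *\<^sub>v v) = k \<cdot>\<^sub>v unit_vec n i"
    using spectral_mat_mult_vec[OF U v, of d] uv by simp
  then have "U *\<^sub>v (mat_adjoint U *\<^sub>v (spectral_mat n U d *\<^sub>v v)) = k \<cdot>\<^sub>v v"
    using u by (simp add: v_def mult_mat_vec[of _ n n])
  then have "spectral_mat n U d *\<^sub>v v = k \<cdot>\<^sub>v v"
    using unitary_mat_mult_vec_cancel(1)[OF U sv] by simp
  then show "k \<in> spectrum (spectral_mat n U d)"
    using v \<open>v \<noteq> _\<close> u(1) by (auto simp: spectrum_def eigenvalue_def eigenvector_def)
qed

section \<open>The spectral theorem for Hermitian matrices\<close>

lemma cscalar_prod_self: "(v :: complex Matrix.vec) \<bullet>c v = of_real (\<Sum>i<dim_vec v. (cmod (v $ i))\<^sup>2)"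
  by (simp add: scalar_prod_def atLeast0LessThan complex_norm_square del: of_real_power)

text \<open>Complete \<open>v\<close> to a basis, orthogonalize, and normalize the columns: the Gram--Schmidt procedure
  produces columns that are orthogonal but not of length one, and leaves the first one unchanged.\<close>
lemma ex_unitary_mat_col_0:
  fixes v :: "complex Matrix.vec"
  assumes v: "v \<in> carrier_vec n" "v \<noteq> 0\<^sub>v n"
  obtains W c where "unitary_mat n W" "col W 0 = c \<cdot>\<^sub>v v"
proof -
  interpret cof_vec_space n "TYPE(complex)" .
  define b where "b = basis_completion v"
  define ws where "ws = gram_schmidt n b"
  have n: "n \<noteq> 0" using v by (metis carrier_vecD eq_vecI index_zero_vec(2) less_nat_zero_code)
  from basis_completion[OF v, folded b_def]
  have dist_b: "distinct b" and indep: "\<not> lin_dep (set b)" and b: "set b \<subseteq> carrier_vec n"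
    and hdb: "hd b = v" and len_b: "length b = n" by auto
  from hdb len_b n obtain vs where bv: "b = v # vs" by (cases b) auto
  from gram_schmidt_result[OF b dist_b indep refl, folded ws_def]
  have ws: "set ws \<subseteq> carrier_vec n" "corthogonal ws" "length ws = n"
    by (auto simp: len_b)
  from gram_schmidt_hd[OF v(1), of vs, folded bv] have "hd ws = v" unfolding ws_def .
  then have ws0: "ws ! 0 = v" using n ws(3) by (cases ws) auto
  define N where "N w = sqrt (\<Sum>i<n. (cmod (w $ i))\<^sup>2)" for w :: "complex Matrix.vec"
  have N: "w \<bullet>c w = of_real ((N w)\<^sup>2)" if "w \<in> carrier_vec n" for w
    using that by (simp add: cscalar_prod_self N_def sum_nonneg)
  define W where "W = Matrix.mat n n (\<lambda>(i, j). ws ! j $ i / of_real (N (ws ! j)))"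
  have W: "W \<in> carrier_mat n n" by (simp add: W_def)
  have "unitary_mat n W"
  proof (rule unitary_matI[OF W], rule eq_matI)
    fix i j assume "i < dim_row (1\<^sub>m n :: complex mat)" "j < dim_col (1\<^sub>m n :: complex mat)"
    then have ij: "i < n" "j < n" by auto
    then have wij: "ws ! i \<in> carrier_vec n" "ws ! j \<in> carrier_vec n" using ws by auto
    have "(mat_adjoint W * W) $$ (i, j) = (\<Sum>k<n. cnj (W $$ (k, i)) * W $$ (k, j))"
      using W ij by (simp add: scalar_prod_def atLeast0LessThan)
    also have "\<dots> = (ws ! j \<bullet>c ws ! i) / (of_real (N (ws ! i)) * of_real (N (ws ! j)))"
      using ij wij by (simp add: W_def scalar_prod_def atLeast0LessThan sum_divide_distrib mult.commute)
    also have "\<dots> = 1\<^sub>m n $$ (i, j)"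
    proof (cases "i = j")
      case True
      have "ws ! i \<bullet>c ws ! i \<noteq> 0" using corthogonalD[OF ws(2), of i i] ws ij by simp
      then show ?thesis using True ij N[OF wij(1)] by (auto simp: power2_eq_square)
    next
      case False
      then show ?thesis using corthogonalD[OF ws(2), of j i] ws ij by simp
    qed
    finally show "(mat_adjoint W * W) $$ (i, j) = 1\<^sub>m n $$ (i, j)" .
  qed (use W in auto)
  moreover have "col W 0 = (1 / of_real (N v)) \<cdot>\<^sub>v v"
    using n v ws0 ws(3) by (intro eq_vecI) (auto simp: W_def)
  ultimately show ?thesis using that by blast
qed

lemma hermitian_matD:
  assumes "hermitian_mat n A"
  shows "A \<in> carrier_mat n n" "i < n \<Longrightarrow> j < n \<Longrightarrow> A $$ (j, i) = cnj (A $$ (i, j))"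
proof -
  show A: "A \<in> carrier_mat n n" using assms by (simp add: hermitian_mat_def)
  assume "i < n" "j < n"
  then have "mat_adjoint A $$ (j, i) = cnj (A $$ (i, j))" using A by simp
  then show "A $$ (j, i) = cnj (A $$ (i, j))" using assms by (simp add: hermitian_mat_def)
qed

lemma hermitian_matI:
  assumes "A \<in> carrier_mat n n" "\<And>i j. i < n \<Longrightarrow> j < n \<Longrightarrow> A $$ (j, i) = cnj (A $$ (i, j))"
  shows "hermitian_mat n A"
  unfolding hermitian_mat_def using assms(1)
  by (intro conjI eq_matI) (simp_all flip: assms(2))

text \<open>Induction on the dimension: a unitary \<open>W\<close> whose first column is an eigenvector makes \<open>W\<^sup>* A W\<close>
  block diagonal, since the first column is a multiple of the first unit vector and Hermitian
  symmetry clears the first row. The remaining block is Hermitian of size one less.\<close>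
theorem spectral_theorem:
  assumes "hermitian_mat n A"
  obtains U d where "unitary_mat n U" "A = spectral_mat n U d"
proof -
  have "\<exists>U d. unitary_mat n U \<and> A = spectral_mat n U d"
    using assms
  proof (induction n arbitrary: A)
    case 0
    then have "A = spectral_mat 0 (1\<^sub>m 0) (\<lambda>_. 0)"
      by (intro eq_matI) (auto simp: hermitian_mat_def)
    moreover have "unitary_mat 0 (1\<^sub>m 0)" by (rule unitary_matI) auto
    ultimately show ?case by blast
  next
    case (Suc n)
    let ?m = "Suc n"
    have A: "A \<in> carrier_mat ?m ?m" and adjA: "mat_adjoint A = A"
      using Suc.prems by (auto simp: hermitian_mat_def)
    obtain e v where v: "v \<in> carrier_vec ?m" "v \<noteq> 0\<^sub>v ?m" and eig: "A *\<^sub>v v = e \<cdot>\<^sub>v v"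
      using spectrum_non_empty[OF A] A by (auto simp: spectrum_def eigenvalue_def eigenvector_def)
    obtain W c where W: "unitary_mat ?m W" and col: "col W 0 = c \<cdot>\<^sub>v v"
      using ex_unitary_mat_col_0[OF v] .
    note w = unitary_matD[OF W]
    define M where "M = mat_adjoint W * (A * W)"
    have M: "M \<in> carrier_mat ?m ?m" using w A by (simp add: M_def mult_carrier_mat[of _ ?m ?m _ ?m])
    have herM: "hermitian_mat ?m M"
      unfolding hermitian_mat_def using w A
      by (simp add: M_def mat_adjoint_mult[of _ ?m ?m _ ?m] adjA assoc_mult_mat[of _ ?m ?m _ ?m _ ?m]
          mult_carrier_mat[of _ ?m ?m _ ?m])
    have "A *\<^sub>v col W 0 = e \<cdot>\<^sub>v col W 0"
      using A v by (simp add: col mult_mat_vec[of _ ?m ?m] eig smult_smult_assoc mult.commute)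
    then have "col (A * W) 0 = e \<cdot>\<^sub>v col W 0"
      using col_mult2[OF A w(1), of 0] by simp
    then have "col M 0 = mat_adjoint W *\<^sub>v (e \<cdot>\<^sub>v col W 0)"
      using w A by (simp add: M_def col_mult2[of _ ?m ?m _ ?m])
    also have "\<dots> = e \<cdot>\<^sub>v (mat_adjoint W *\<^sub>v col W 0)"
      using w by (intro mult_mat_vec[of _ ?m ?m] col_carrier_vec[OF _ w(1)]) auto
    also have "mat_adjoint W *\<^sub>v col W 0 = unit_vec ?m 0"
      using col_mult2[OF w(2) w(1), of 0] w by simp
    finally have colM: "col M 0 = e \<cdot>\<^sub>v unit_vec ?m 0" .
    have M0: "M $$ (i, 0) = (if i = 0 then e else 0)" if "i < ?m" for i
      using arg_cong[OF colM, of "\<lambda>x. x $ i"] that M by auto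
    have M0': "M $$ (0, i) = (if i = 0 then e else 0)" if "i < ?m" for i
      using hermitian_matD(2)[OF herM, of i 0] M0[OF that] M0[of 0] that by (auto split: if_splits)
    have e: "cnj e = e" using hermitian_matD(2)[OF herM, of 0 0] M0[of 0] by simp
    then have e': "of_real (Re e) = e" by (simp add: complex_eq_iff)
    define A' where "A' = Matrix.mat n n (\<lambda>(i, j). M $$ (Suc i, Suc j))"
    have "hermitian_mat n A'"
      by (rule hermitian_matI) (auto simp: A'_def intro: hermitian_matD(2)[OF herM])
    from Suc.IH[OF this] obtain U' d' where U': "unitary_mat n U'" and A'eq: "A' = spectral_mat n U' d'"
      by blast
    note u' = unitary_matD[OF U']
    have A'sum: "M $$ (Suc i, Suc j) = (\<Sum>k<n. U' $$ (i, k) * of_real (d' k) * cnj (U' $$ (j, k)))"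
      if "i < n" "j < n" for i j
      using arg_cong[OF A'eq, of "\<lambda>X. X $$ (i, j)"] that u' by (simp add: spectral_mat_index) (simp add: A'_def)
    define X where "X = Matrix.mat ?m ?m (\<lambda>(i, j). if i = 0 \<and> j = 0 then 1
        else if i = 0 \<or> j = 0 then 0 else U' $$ (i - 1, j - 1))"
    define d where "d i = (case i of 0 \<Rightarrow> Re e | Suc i \<Rightarrow> d' i)" for i
    have X: "X \<in> carrier_mat ?m ?m" by (simp add: X_def)
    have u'sum: "(\<Sum>k<n. cnj (U' $$ (k, i)) * U' $$ (k, j)) = (if i = j then 1 else 0)"
      if "i < n" "j < n" for i j
      using arg_cong[OF u'(3), of "\<lambda>X. X $$ (i, j)"] that u'(1)
      by (simp add: scalar_prod_def atLeast0LessThan)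
    have uX: "unitary_mat ?m X"
    proof (rule unitary_matI[OF X], rule eq_matI)
      fix i j assume "i < dim_row (1\<^sub>m ?m :: complex mat)" "j < dim_col (1\<^sub>m ?m :: complex mat)"
      then have ij: "i < ?m" "j < ?m" by auto
      then have "(mat_adjoint X * X) $$ (i, j) = (\<Sum>k<?m. cnj (X $$ (k, i)) * X $$ (k, j))"
        using X by (simp add: scalar_prod_def atLeast0LessThan)
      also have "\<dots> = 1\<^sub>m ?m $$ (i, j)"
        using ij by (cases i; cases j)
          (simp_all add: X_def sum.lessThan_Suc_shift u'sum del: sum.lessThan_Suc)
      finally show "(mat_adjoint X * X) $$ (i, j) = 1\<^sub>m ?m $$ (i, j)" .
    qed (use X in auto)
    have Meq: "M = spectral_mat ?m X d"
    proof (rule eq_matI)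
      fix i j assume "i < dim_row (spectral_mat ?m X d)" "j < dim_col (spectral_mat ?m X d)"
      then have ij: "i < ?m" "j < ?m" using X by auto
      then show "M $$ (i, j) = spectral_mat ?m X d $$ (i, j)"
        using X by (cases i; cases j)
          (simp_all add: spectral_mat_index M0 M0' A'sum X_def d_def sum.lessThan_Suc_shift e'
            del: sum.lessThan_Suc)
    qed (use X M in auto)
    have "W * M = A * W"
      unfolding M_def using w A by (intro unitary_mat_mult_cancel(2)[OF W]) auto
    then have "A = W * M * mat_adjoint W"
      using w A by (simp add: assoc_mult_mat[of A ?m ?m W ?m _ ?m])
    also have "\<dots> = spectral_mat ?m (W * X) d"
      unfolding Meq spectral_mat_def mat_adjoint_mult[OF w(1) X]
      using w(1,2) X mat_adjoint_carrier[OF X]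
      by (simp add: assoc_mult_mat[of _ ?m ?m _ ?m _ ?m] mult_carrier_mat[of _ ?m ?m _ ?m])
    finally show ?case using unitary_mat_mult[OF W uX] by blast
  qed
  then show ?thesis using that by blast
qed

section \<open>Divided differences and partial fractions\<close>

text \<open>A divided difference does not depend on the order of its points, so it is a function of the
  finite set of points.\<close>
definition div_diff :: "real set \<Rightarrow> (real \<Rightarrow> real) \<Rightarrow> real" where
  "div_diff X g = (\<Sum>x\<in>X. g x / (\<Prod>y\<in>X - {x}. x - y))"

lemma divided_difference_eq_div_diff:
  assumes "inj_on x {..m}"
  shows "divided_difference m x g = div_diff (x ` {..m}) g"
proof -
  have "(\<Prod>y\<in>x ` {..m} - {x i}. x i - y) = (\<Prod>j\<in>{..m} - {i}. x i - x j)" if "i \<le> m" for i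
  proof -
    have "x ` {..m} - {x i} = x ` ({..m} - {i})"
      using inj_on_image_set_diff[OF assms, of "{..m}" "{i}"] that by simp
    moreover have "inj_on x ({..m} - {i})" using assms by (rule inj_on_subset) auto
    ultimately show ?thesis by (simp add: prod.reindex)
  qed
  then show ?thesis
    unfolding divided_difference_def div_diff_def by (simp add: sum.reindex[OF assms])
qed

lemma div_diff_add: "div_diff X (\<lambda>t. g t + h t) = div_diff X g + div_diff X h"
  by (simp add: div_diff_def add_divide_distrib sum.distrib)

text \<open>The condition on \<open>f\<close> for a given \<open>n\<close>. For \<open>n = 0\<close> the only set of points is empty, so that the
  condition holds trivially in spite of the bound \<open>n - 1 = 0\<close> on the degree.\<close>
definition square_positive :: "nat \<Rightarrow> real set \<Rightarrow> (real \<Rightarrow> real) \<Rightarrow> bool" where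
  "square_positive n I f \<longleftrightarrow> (\<forall>X (q :: real poly). finite X \<longrightarrow> X \<subseteq> I \<longrightarrow> card X = 2 * n \<longrightarrow> degree q \<le> n - 1 \<longrightarrow>
     0 \<le> div_diff X (\<lambda>t. f t * (poly q t)\<^sup>2))"

lemma square_positiveD:
  assumes "square_positive n I f" "finite X" "X \<subseteq> I" "card X = 2 * n" "degree q \<le> n - 1"
  shows "0 \<le> div_diff X (\<lambda>t. f t * (poly q t)\<^sup>2)"
  using assms unfolding square_positive_def by blast

text \<open>Add two points \<open>y\<close>, \<open>z\<close> to \<open>X\<close> and replace \<open>q\<close> by \<open>q (t - y)\<close>. With the factor
  \<open>(t - y) (t - z)\<close> in place of \<open>(t - y)\<^sup>2\<close> both points would cancel from the divided difference.
  The square causes an error that vanishes as \<open>y\<close> tends to \<open>z\<close>: the term at \<open>y\<close> is zero, and the term at the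
  fixed point \<open>z\<close> carries a factor \<open>z - y\<close>. Thus \<open>f\<close> is only evaluated at points that do not move,
  and the limit exists for any \<open>f\<close>.\<close>
lemma square_positive_Suc:
  assumes sp: "square_positive (Suc k) I f" and I: "open I" "I \<noteq> {}"
  shows "square_positive k I f"
proof (cases "k = 0")
  case True
  then show ?thesis by (auto simp: square_positive_def div_diff_def)
next
  case False
  show ?thesis
    unfolding square_positive_def
  proof (intro allI impI)
    fix X :: "real set" and q :: "real poly"
    assume X: "finite X" "X \<subseteq> I" "card X = 2 * k" and q: "degree q \<le> k - 1"
    define g where "g t = f t * (poly q t)\<^sup>2" for t
    have "infinite I" using I by (metis finite_imp_not_open)
    then obtain z where z: "z \<in> I" "z \<notin> X" using X(1) by (meson finite_subset subsetI)
    define F where "F y = (\<Sum>x\<in>X. g x / (\<Prod>w\<in>X - {x}. x - w) * ((x - y) / (x - z)))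
        + g z / (\<Prod>w\<in>X. z - w) * (z - y)" for y
    have "(F \<longlongrightarrow> (\<Sum>x\<in>X. g x / (\<Prod>w\<in>X - {x}. x - w) * ((x - z) / (x - z)))
        + g z / (\<Prod>w\<in>X. z - w) * (z - z)) (at z)"
      unfolding F_def by (intro tendsto_intros) (use z in auto)
    moreover have "(\<Sum>x\<in>X. g x / (\<Prod>w\<in>X - {x}. x - w) * ((x - z) / (x - z))) = div_diff X g"
      unfolding div_diff_def using z by (intro sum.cong) auto
    ultimately have lim: "(F \<longlongrightarrow> div_diff X g) (at z)" by simp
    have "\<forall>\<^sub>F y in at z. y \<in> I" using z I by (auto simp: eventually_at_topological)
    moreover have "\<forall>\<^sub>F y in at z. y \<notin> X \<and> y \<noteq> z"
      using finite_imp_closed[OF X(1)] z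
      by (auto simp: eventually_at_topological intro!: exI[of _ "- X"])
    ultimately have "\<forall>\<^sub>F y in at z. 0 \<le> F y"
    proof eventually_elim
      case (elim y)
      let ?X = "insert y (insert z X)"
      have "card ?X = 2 * Suc k" using X z elim by simp
      moreover have "degree ([:-y, 1:] * q) \<le> Suc k - 1"
        using degree_mult_le[of "[:-y, 1:]" q] q False by simp
      ultimately have "0 \<le> div_diff ?X (\<lambda>t. f t * (poly ([:-y, 1:] * q) t)\<^sup>2)"
        using X z elim by (intro square_positiveD[OF sp]) auto
      also have "\<dots> = div_diff ?X (\<lambda>t. g t * (t - y)\<^sup>2)"
        unfolding g_def poly_mult power_mult_distrib by (simp add: ac_simps)
      also have "\<dots> = F y"
      proof -
        define T where "T x = g x * (x - y)\<^sup>2 / (\<Prod>w\<in>?X - {x}. x - w)" for x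
        have TX: "T x = g x / (\<Prod>w\<in>X - {x}. x - w) * ((x - y) / (x - z))"
          if "x \<in> X" for x
        proof -
          have "?X - {x} = insert y (insert z (X - {x}))" using that elim z by auto
          then have "(\<Prod>w\<in>?X - {x}. x - w) = (x - y) * ((x - z) * (\<Prod>w\<in>X - {x}. x - w))"
            using X elim z by simp
          moreover have "x - y \<noteq> 0" using that elim by auto
          ultimately show ?thesis by (simp add: T_def power2_eq_square)
        qed
        have Tz: "T z = g z / (\<Prod>w\<in>X. z - w) * (z - y)"
        proof -
          have "?X - {z} = insert y X" using elim z by auto
          then have "(\<Prod>w\<in>?X - {z}. z - w) = (z - y) * (\<Prod>w\<in>X. z - w)"
            using X elim z by simp
          moreover have "z - y \<noteq> 0" using elim by auto
          ultimately show ?thesis by (simp add: T_def power2_eq_square)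
        qed
        have "div_diff ?X (\<lambda>t. g t * (t - y)\<^sup>2) = T y + (T z + (\<Sum>x\<in>X. T x))"
          unfolding div_diff_def T_def[symmetric] using X(1) elim z(2) by simp
        also have "T y = 0" by (simp add: T_def)
        also have "(\<Sum>x\<in>X. T x) = (\<Sum>x\<in>X. g x / (\<Prod>w\<in>X - {x}. x - w) * ((x - y) / (x - z)))"
          by (rule sum.cong[OF refl TX])
        finally show ?thesis by (simp add: F_def Tz)
      qed
      finally show ?case .
    qed
    with lim have "0 \<le> div_diff X g"
      by (intro tendsto_lowerbound[of F _ "at z"]) auto
    then show "0 \<le> div_diff X (\<lambda>t. f t * (poly q t)\<^sup>2)" by (simp add: g_def[abs_def])
  qed
qed

lemma square_positive_mono:
  assumes "square_positive n I f" "k \<le> n" "open I" "I \<noteq> {}"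
  shows "square_positive k I f"
  using assms(2)
proof (induction rule: inc_induct)
  case base
  show ?case by (rule assms(1))
next
  case (step j)
  show ?case by (rule square_positive_Suc[OF step.IH assms(3,4)])
qed

definition node_poly :: "real set \<Rightarrow> real poly" where
  "node_poly X = (\<Prod>x\<in>X. [:-x, 1:])"

text \<open>The numerator of \<open>\<Sum>x\<in>X. c x / (t - x)\<close> over the common denominator \<open>node_poly X\<close>. Lagrange
  interpolation says that every polynomial of degree less than \<open>card X\<close> is of this form.\<close>
definition partial_fraction_num :: "real set \<Rightarrow> (real \<Rightarrow> real) \<Rightarrow> real poly" where
  "partial_fraction_num X c = (\<Sum>x\<in>X. Polynomial.smult (c x) (node_poly (X - {x})))"

lemma poly_node_poly [simp]: "poly (node_poly X) t = (\<Prod>x\<in>X. t - x)"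
  by (simp add: node_poly_def poly_prod)

lemma degree_node_poly [simp]: "degree (node_poly X) = card X"
  by (cases "finite X") (simp_all add: node_poly_def degree_prod_eq_sum_degree)

lemma lead_coeff_node_poly: "lead_coeff (node_poly X) = 1"
  by (cases "finite X") (simp_all add: node_poly_def lead_coeff_prod)

lemma degree_partial_fraction_num:
  assumes "finite X"
  shows "degree (partial_fraction_num X c) \<le> card X - 1"
  unfolding partial_fraction_num_def
  by (intro degree_sum_le) (use assms in \<open>auto intro!: order_trans[OF degree_smult_le]\<close>)

lemma poly_partial_fraction_num_node:
  assumes "finite X" "x \<in> X"
  shows "poly (partial_fraction_num X c) x = c x * (\<Prod>y\<in>X - {x}. x - y)"
proof -
  have "poly (partial_fraction_num X c) x = (\<Sum>z\<in>X. if z = x then c x * (\<Prod>y\<in>X - {x}. x - y) else 0)"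
    unfolding partial_fraction_num_def poly_sum using assms
    by (intro sum.cong) (auto simp: prod_zero_iff)
  then show ?thesis using assms by simp
qed

lemma poly_partial_fraction_num:
  assumes "finite X" "t \<notin> X"
  shows "poly (partial_fraction_num X c) t / (\<Prod>x\<in>X. t - x) = (\<Sum>x\<in>X. c x / (t - x))"
proof -
  have "c x * (\<Prod>y\<in>X - {x}. t - y) / (\<Prod>x\<in>X. t - x) = c x / (t - x)" if "x \<in> X" for x
  proof -
    have "(\<Prod>x\<in>X. t - x) = (t - x) * (\<Prod>y\<in>X - {x}. t - y)"
      using assms that by (intro prod.remove) auto
    moreover have "(\<Prod>y\<in>X - {x}. t - y) \<noteq> 0" using assms by (auto simp: prod_zero_iff)
    ultimately show ?thesis by simp
  qed
  then show ?thesis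
    by (simp add: partial_fraction_num_def poly_sum sum_divide_distrib)
qed

lemma poly_eqI_nodes:
  fixes p q :: "real poly"
  assumes "finite X" "\<And>x. x \<in> X \<Longrightarrow> poly p x = poly q x" "degree p < card X" "degree q < card X"
  shows "p = q"
  using assms by (intro poly_eqI_degree[of X]) auto

lemma lagrange_interpolation:
  fixes p :: "real poly"
  assumes X: "finite X" and deg: "degree p < card X"
  shows "p = partial_fraction_num X (\<lambda>x. poly p x / (\<Prod>y\<in>X - {x}. x - y))"
    (is "p = partial_fraction_num X ?c")
proof (rule poly_eqI_nodes[OF X _ deg])
  show "degree (partial_fraction_num X ?c) < card X"
    using degree_partial_fraction_num[OF X, of ?c] deg by linarith
  fix x assume "x \<in> X"
  moreover have "(\<Prod>y\<in>X - {x}. x - y) \<noteq> 0" using X by (auto simp: prod_zero_iff)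
  ultimately show "poly p x = poly (partial_fraction_num X ?c) x"
    by (simp add: poly_partial_fraction_num_node X)
qed

lemma lagrange_partial_fractions:
  fixes p :: "real poly"
  assumes X: "finite X" and deg: "degree p < card X" and t: "t \<notin> X"
  shows "poly p t / (\<Prod>x\<in>X. t - x) = (\<Sum>x\<in>X. poly p x / (\<Prod>y\<in>X - {x}. x - y) / (t - x))"
  using arg_cong[OF lagrange_interpolation[OF X deg], of "\<lambda>p. poly p t"] poly_partial_fraction_num[OF X t]
  by simp

text \<open>Compare the leading coefficients in the Lagrange interpolation formula.\<close>
lemma div_diff_poly:
  fixes p :: "real poly"
  assumes X: "finite X" and deg: "degree p < card X"
  shows "div_diff X (poly p) = coeff p (card X - 1)"
proof -
  have "coeff (node_poly (X - {x})) (card X - 1) = 1" if "x \<in> X" for x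
    using lead_coeff_node_poly[of "X - {x}"] X that by simp
  then have "coeff (partial_fraction_num X c) (card X - 1) = (\<Sum>x\<in>X. c x)" for c
    by (simp add: partial_fraction_num_def coeff_sum)
  then show ?thesis
    using arg_cong[OF lagrange_interpolation[OF X deg], of "\<lambda>p. coeff p (card X - 1)"]
    by (simp add: div_diff_def)
qed

text \<open>Multiply the difference of both sides by \<open>z - t\<close> and let \<open>t\<close> tend to \<open>z\<close>: only the coefficient
  at \<open>z\<close> survives.\<close>
lemma partial_fractions_unique:
  fixes m m' :: "real \<Rightarrow> real"
  assumes Z: "finite Z" and eq: "\<And>t. t \<notin> Z \<Longrightarrow> (\<Sum>x\<in>Z. m x / (x - t)) = (\<Sum>x\<in>Z. m' x / (x - t))"
    and z: "z \<in> Z"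
  shows "m z = m' z"
proof -
  define c where "c x = m x - m' x" for x
  have eq0: "(\<Sum>x\<in>Z. c x / (x - t)) = 0" if "t \<notin> Z" for t
    using eq[OF that] by (simp add: c_def diff_divide_distrib sum_subtractf)
  define F where "F t = c z + (z - t) * (\<Sum>x\<in>Z - {z}. c x / (x - t))" for t
  have "(F \<longlongrightarrow> c z + (z - z) * (\<Sum>x\<in>Z - {z}. c x / (x - z))) (at z)"
    unfolding F_def by (intro tendsto_intros) auto
  then have lim: "(F \<longlongrightarrow> c z) (at z)" by simp
  have "open (- (Z - {z}))" using Z by (intro open_Compl finite_imp_closed) auto
  then have "\<forall>\<^sub>F t in at z. t \<notin> Z"
    unfolding eventually_at_topological by (intro exI[of _ "- (Z - {z})"]) auto
  then have "\<forall>\<^sub>F t in at z. F t = 0"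
  proof eventually_elim
    case (elim t)
    have "z - t \<noteq> 0" using elim z by auto
    then have "(z - t) * (\<Sum>x\<in>Z. c x / (x - t)) = F t"
      unfolding F_def sum.remove[OF Z z] by (simp add: distrib_left)
    then show ?case using eq0[OF elim] by simp
  qed
  then have "(F \<longlongrightarrow> 0) (at z)" using tendsto_eventually by blast
  then show ?thesis using LIM_unique[OF lim, of 0] by (simp add: c_def)
qed

section \<open>The rational functions of a rank-one perturbation\<close>

lemma poly_eqI_cofinite:
  fixes p q :: "real poly"
  assumes "finite Z" "\<And>t. t \<notin> Z \<Longrightarrow> poly p t = poly q t"
  shows "p = q"
proof (rule ccontr)
  assume "p \<noteq> q"
  then have "finite {t. poly (p - q) t = 0}" by (intro poly_roots_finite) simp
  moreover have "- Z \<subseteq> {t. poly (p - q) t = 0}" using assms(2) by auto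
  ultimately have "finite (- Z)" using finite_subset by blast
  then show False using assms(1) by (metis Compl_partition finite_Un infinite_UNIV_char_0)
qed

text \<open>A purely algebraic form of the statement that a rank-one perturbation moves the relevant
  eigenvalues \<open>S\<close> of \<open>A\<close> to equally many others \<open>M\<close>. Write the two factors as \<open>P / node_poly S\<close> and
  \<open>Q / node_poly M\<close> with \<open>P\<close>, \<open>Q\<close> monic of degrees \<open>card S\<close>, \<open>card M\<close>; then
  \<open>P Q = node_poly S * node_poly M\<close>. Because the coefficients \<open>\<alpha>\<close>, \<open>\<beta>\<close> do not vanish, \<open>P\<close> has no
  root in \<open>S\<close> and \<open>Q\<close> has no root in \<open>M\<close>. So \<open>Q\<close> vanishes on \<open>S\<close> and \<open>P\<close> vanishes on \<open>M\<close>, and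
  comparing degrees yields \<open>P = node_poly M\<close>. In particular the roots of \<open>P\<close> are real and simple.\<close>
lemma reciprocal_partial_fractions:
  fixes \<alpha> \<beta> :: "real \<Rightarrow> real"
  assumes S: "finite S" "\<And>x. x \<in> S \<Longrightarrow> \<alpha> x \<noteq> 0" and M: "finite M" "\<And>x. x \<in> M \<Longrightarrow> \<beta> x \<noteq> 0"
    and Z: "finite Z" "S \<subseteq> Z" "M \<subseteq> Z"
    and recip: "\<And>t. t \<notin> Z \<Longrightarrow> (1 + (\<Sum>x\<in>S. \<alpha> x / (x - t))) * (1 - (\<Sum>x\<in>M. \<beta> x / (x - t))) = 1"
  shows "card S = card M" "S \<inter> M = {}"
    "\<And>t. t \<notin> S \<Longrightarrow> 1 + (\<Sum>x\<in>S. \<alpha> x / (x - t)) = (\<Prod>x\<in>M. t - x) / (\<Prod>x\<in>S. t - x)"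
proof -
  define P where "P = node_poly S - partial_fraction_num S \<alpha>"
  define Q where "Q = node_poly M + partial_fraction_num M \<beta>"
  have nz: "(\<Prod>x\<in>Y. t - x) \<noteq> 0" if "finite Y" "t \<notin> Y" for Y and t :: real
    using that by (auto simp: prod_zero_iff)
  have flip: "(\<Sum>x\<in>Y. c x / (x - t)) = - (\<Sum>x\<in>Y. c x / (t - x))" for Y c and t :: real
    unfolding sum_negf[symmetric] by (intro sum.cong refl) (metis minus_diff_eq minus_divide_right)
  have P: "poly P t / (\<Prod>x\<in>S. t - x) = 1 + (\<Sum>x\<in>S. \<alpha> x / (x - t))" if "t \<notin> S" for t
    using poly_partial_fraction_num[OF S(1) that, of \<alpha>] nz[OF S(1) that] flip[of \<alpha> t S]
    by (simp add: P_def diff_divide_distrib)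
  have Q: "poly Q t / (\<Prod>x\<in>M. t - x) = 1 - (\<Sum>x\<in>M. \<beta> x / (x - t))" if "t \<notin> M" for t
    using poly_partial_fraction_num[OF M(1) that, of \<beta>] nz[OF M(1) that] flip[of \<beta> t M]
    by (simp add: Q_def add_divide_distrib)
  have PQ: "P * Q = node_poly S * node_poly M"
  proof (rule poly_eqI_cofinite[OF Z(1)])
    fix t assume "t \<notin> Z"
    then have t: "t \<notin> S" "t \<notin> M" using Z by auto
    have "poly P t / (\<Prod>x\<in>S. t - x) * (poly Q t / (\<Prod>x\<in>M. t - x)) = 1"
      using recip[OF \<open>t \<notin> Z\<close>] P[OF t(1)] Q[OF t(2)] by simp
    then show "poly (P * Q) t = poly (node_poly S * node_poly M) t"
      using nz[OF S(1) t(1)] nz[OF M(1) t(2)] by (simp add: field_simps)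
  qed
  have node_nz: "node_poly Y \<noteq> 0" for Y
    using lead_coeff_node_poly[of Y] by auto
  have PQ0: "P \<noteq> 0" "Q \<noteq> 0" using PQ node_nz[of S] node_nz[of M] by auto
  have PS: "poly P x \<noteq> 0" if "x \<in> S" for x
  proof -
    have "poly (node_poly S) x = 0" using that S(1) by auto
    then have "poly P x = - (\<alpha> x * (\<Prod>y\<in>S - {x}. x - y))"
      by (simp only: P_def poly_diff poly_partial_fraction_num_node[OF S(1) that] diff_0)
    then show ?thesis using nz[of "S - {x}" x] S that by simp
  qed
  have QM: "poly Q x \<noteq> 0" if "x \<in> M" for x
  proof -
    have "poly (node_poly M) x = 0" using that M(1) by auto
    then have "poly Q x = \<beta> x * (\<Prod>y\<in>M - {x}. x - y)"
      by (simp only: Q_def poly_add poly_partial_fraction_num_node[OF M(1) that] add_0)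
    then show ?thesis using nz[of "M - {x}" x] M that by simp
  qed
  have PQx: "poly P x * poly Q x = (\<Prod>y\<in>S. x - y) * (\<Prod>y\<in>M. x - y)" for x
    using arg_cong[OF PQ, of "\<lambda>p. poly p x"] by simp
  have QS: "poly Q x = 0" if "x \<in> S" for x
  proof -
    have "(\<Prod>y\<in>S. x - y) = 0" using that S(1) by (intro prod_zero) auto
    then show ?thesis using PQx[of x] PS[OF that] by simp
  qed
  have PM: "poly P x = 0" if "x \<in> M" for x
  proof -
    have "(\<Prod>y\<in>M. x - y) = 0" using that M(1) by (intro prod_zero) auto
    then show ?thesis using PQx[of x] QM[OF that] by simp
  qed
  have degP: "degree P \<le> card S" unfolding P_def
    using degree_partial_fraction_num[OF S(1), of \<alpha>] by (intro degree_diff_le) auto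
  have degQ: "degree Q \<le> card M" unfolding Q_def
    using degree_partial_fraction_num[OF M(1), of \<beta>] by (intro degree_add_le) auto
  have "card S \<le> card {x. poly Q x = 0}"
    by (intro card_mono) (use QS poly_roots_finite[OF PQ0(2)] in auto)
  also have "\<dots> \<le> degree Q" using PQ0(2) by (rule poly_roots_degree)
  finally have le1: "card S \<le> card M" using degQ by simp
  have "card M \<le> card {x. poly P x = 0}"
    by (intro card_mono) (use PM poly_roots_finite[OF PQ0(1)] in auto)
  also have "\<dots> \<le> degree P" using PQ0(1) by (rule poly_roots_degree)
  finally have "card M \<le> card S" using degP by simp
  with le1 show card: "card S = card M" by simp
  show "S \<inter> M = {}" using PS PM by blast
  have "coeff (partial_fraction_num S \<alpha>) (card S) = 0"
  proof (cases "S = {}")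
    case False
    then have "card S > 0" using S by (simp add: card_gt_0_iff)
    then show ?thesis using degree_partial_fraction_num[OF S(1), of \<alpha>] by (intro coeff_eq_0) linarith
  qed (simp add: partial_fraction_num_def)
  then have "coeff (P - node_poly M) (card M) = 0"
    using lead_coeff_node_poly[of S] lead_coeff_node_poly[of M] card by (simp add: P_def)
  moreover have "degree (P - node_poly M) \<le> card M"
    using degP card by (intro degree_diff_le) auto
  ultimately have small: "P - node_poly M = 0 \<or> degree (P - node_poly M) < card M"
    using eq_zero_or_degree_less by blast
  have "P - node_poly M = 0"
  proof (rule ccontr)
    assume ne: "P - node_poly M \<noteq> 0"
    have "card M \<le> card {x. poly (P - node_poly M) x = 0}"
      by (intro card_mono) (use PM M(1) poly_roots_finite[OF ne] in auto)
    also have "\<dots> \<le> degree (P - node_poly M)" using ne by (rule poly_roots_degree)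
    finally show False using small ne by simp
  qed
  then have "poly P t = (\<Prod>x\<in>M. t - x)" for t by simp
  then show "1 + (\<Sum>x\<in>S. \<alpha> x / (x - t)) = (\<Prod>x\<in>M. t - x) / (\<Prod>x\<in>S. t - x)" if "t \<notin> S" for t
    using P[OF that] by simp
qed

text \<open>In the application, \<open>Z\<close> contains the eigenvalues of \<open>A\<close> and of \<open>B = A + v v\<^sup>*\<close>; with \<open>P\<^sub>x\<close>, \<open>Q\<^sub>x\<close> the
  spectral projections of \<open>A\<close>, \<open>B\<close>, \<open>\<alpha> x = (P\<^sub>x v, v)\<close> and \<open>\<beta> x = (Q\<^sub>x v, v)\<close>,
  \<open>c1 x\<close> and \<open>c2 x\<close> are the real and imaginary parts of \<open>(P\<^sub>x w, v)\<close>, \<open>m x = (Q\<^sub>x w, w) - (P\<^sub>x w, w)\<close>. The two hypotheses on \<open>t\<close> are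
  the resolvent identities. After cancellation, \<open>\<Sum>x\<in>Z. m x / (x - t)\<close> equals
  \<open>- (q1(t)\<^sup>2 + q2(t)\<^sup>2) / node_poly X (t)\<close>, and uniqueness of partial fractions determines \<open>m\<close>:
  it lives on \<open>X\<close>, where it consists of the coefficients of a divided difference.\<close>
lemma rank_one_weights_div_diff:
  fixes \<alpha> \<beta> c1 c2 m :: "real \<Rightarrow> real"
  assumes Z: "finite Z"
    and c: "\<And>x. \<alpha> x = 0 \<Longrightarrow> c1 x = 0" "\<And>x. \<alpha> x = 0 \<Longrightarrow> c2 x = 0"
    and recip: "\<And>t. t \<notin> Z \<Longrightarrow> (1 + (\<Sum>x\<in>Z. \<alpha> x / (x - t))) * (1 - (\<Sum>x\<in>Z. \<beta> x / (x - t))) = 1"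
    and diff: "\<And>t. t \<notin> Z \<Longrightarrow> (\<Sum>x\<in>Z. m x / (x - t)) * (1 + (\<Sum>x\<in>Z. \<alpha> x / (x - t)))
      = - ((\<Sum>x\<in>Z. c1 x / (x - t))\<^sup>2 + (\<Sum>x\<in>Z. c2 x / (x - t))\<^sup>2)"
  obtains X q1 q2 where "X \<subseteq> Z" "card X = 2 * card {x \<in> Z. \<alpha> x \<noteq> 0}"
    "degree q1 \<le> card {x \<in> Z. \<alpha> x \<noteq> 0} - 1" "degree q2 \<le> card {x \<in> Z. \<alpha> x \<noteq> 0} - 1"
    "\<And>g. (\<Sum>x\<in>Z. g x * m x)
      = div_diff X (\<lambda>t. g t * (poly q1 t)\<^sup>2) + div_diff X (\<lambda>t. g t * (poly q2 t)\<^sup>2)"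
proof -
  define S where "S = {x \<in> Z. \<alpha> x \<noteq> 0}"
  define M where "M = {x \<in> Z. \<beta> x \<noteq> 0}"
  have fin: "finite S" "finite M" using Z by (simp_all add: S_def M_def)
  have sumS: "(\<Sum>x\<in>Z. h x / (x - t)) = (\<Sum>x\<in>S. h x / (x - t))"
    if "\<And>x. \<alpha> x = 0 \<Longrightarrow> h x = 0" for h t
    using Z that by (intro sum.mono_neutral_right) (auto simp: S_def)
  have sumM: "(\<Sum>x\<in>Z. \<beta> x / (x - t)) = (\<Sum>x\<in>M. \<beta> x / (x - t))" for t
    using Z by (intro sum.mono_neutral_right) (auto simp: M_def)
  have r: "(1 + (\<Sum>x\<in>S. \<alpha> x / (x - t))) * (1 - (\<Sum>x\<in>M. \<beta> x / (x - t))) = 1" if "t \<notin> Z" for t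
    using recip[OF that] sumS[of \<alpha> t] sumM[of t] by simp
  have nz: "\<And>x. x \<in> S \<Longrightarrow> \<alpha> x \<noteq> 0" "\<And>x. x \<in> M \<Longrightarrow> \<beta> x \<noteq> 0" and sub: "S \<subseteq> Z" "M \<subseteq> Z"
    by (auto simp: S_def M_def)
  note recip' = reciprocal_partial_fractions[OF fin(1) nz(1) fin(2) nz(2) Z sub r]
  have "card S = card M" and disj: "S \<inter> M = {}" by (rule recip'; assumption)+
  have phi: "1 + (\<Sum>x\<in>S. \<alpha> x / (x - t)) = (\<Prod>x\<in>M. t - x) / (\<Prod>x\<in>S. t - x)" if "t \<notin> S" for t
    using that by (rule recip'(3)[rotated -1])
  define X where "X = S \<union> M"
  have X: "finite X" "X \<subseteq> Z" using Z fin by (auto simp: X_def S_def M_def)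
  have cardX: "card X = 2 * card S"
    using card_Un_disjoint[OF fin disj] \<open>card S = card M\<close> by (simp add: X_def)
  define q1 q2 where "q1 = partial_fraction_num S c1" and "q2 = partial_fraction_num S c2"
  have deg: "degree q1 \<le> card S - 1" "degree q2 \<le> card S - 1"
    using degree_partial_fraction_num[OF fin(1)] by (simp_all add: q1_def q2_def)
  define G where "G = q1\<^sup>2 + q2\<^sup>2"
  define m' where "m' x = (if x \<in> X then poly G x / (\<Prod>y\<in>X - {x}. x - y) else 0)" for x
  have sum_m': "(\<Sum>x\<in>Z. g x * m' x) = (\<Sum>x\<in>X. g x * (poly G x / (\<Prod>y\<in>X - {x}. x - y)))" for g
    unfolding m'_def using X Z by (intro sum.mono_neutral_cong_right) auto
  have flip: "h x / (x - t) = - (h x / (t - x))" for h and x t :: real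
    by (metis minus_diff_eq minus_divide_right)
  have "(\<Sum>x\<in>Z. m x / (x - t)) = (\<Sum>x\<in>Z. m' x / (x - t))" if t: "t \<notin> Z" for t
  proof -
    have tS: "t \<notin> S" "t \<notin> M" "t \<notin> X" using t X by (auto simp: S_def M_def)
    \<comment> \<open>The numerators have denominator \<open>s\<close>, so the right side has denominator \<open>s\<^sup>2\<close>, one factor of which cancels.\<close>
    define s n where "s = (\<Prod>x\<in>S. t - x)" and "n = (\<Prod>x\<in>M. t - x)"
    have nz: "s \<noteq> 0" "n \<noteq> 0" using tS fin by (auto simp: s_def n_def prod_zero_iff)
    have q: "(\<Sum>x\<in>Z. h x / (x - t)) = - (poly (partial_fraction_num S h) t / s)"
      if "\<And>x. \<alpha> x = 0 \<Longrightarrow> h x = 0" for h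
    proof -
      have "(\<Sum>x\<in>Z. h x / (x - t)) = (\<Sum>x\<in>S. h x / (x - t))" using that by (rule sumS)
      also have "\<dots> = - (\<Sum>x\<in>S. h x / (t - x))" unfolding flip[of h _ t] sum_negf ..
      finally show ?thesis unfolding s_def poly_partial_fraction_num[OF fin(1) tS(1)] .
    qed
    have "(\<Sum>x\<in>Z. m x / (x - t)) * (n / s) = - (poly G t / s\<^sup>2)"
      using diff[OF t] phi[OF tS(1)] sumS[of \<alpha> t] q[OF c(1)] q[OF c(2)]
      by (simp add: G_def q1_def q2_def power_divide add_divide_distrib s_def n_def)
    then have "(\<Sum>x\<in>Z. m x / (x - t)) = - (poly G t / (s * n))"
      using nz by (simp add: field_simps power2_eq_square)
    also have "s * n = (\<Prod>x\<in>X. t - x)"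
      unfolding s_def n_def X_def by (rule prod.union_disjoint[OF fin disj, symmetric])
    also have "poly G t / (\<Prod>x\<in>X. t - x) = (\<Sum>x\<in>X. poly G x / (\<Prod>y\<in>X - {x}. x - y) / (t - x))"
    \<comment> \<open>For \<open>S = {}\<close> the degree bound \<open>card S - 1\<close> truncates to \<open>0\<close>, which is not less than \<open>card X = 0\<close>.\<close>
    proof (cases "S = {}")
      case True
      then have "X = {}" using cardX X(1) by simp
      moreover have "G = 0" using True by (simp add: G_def q1_def q2_def partial_fraction_num_def)
      ultimately show ?thesis by simp
    next
      case False
      then have "card S > 0" using fin by (simp add: card_gt_0_iff)
      have "degree G \<le> 2 * (card S - 1)"
        unfolding G_def using deg
        by (intro degree_add_le order_trans[OF degree_power_le]) auto
      also have "\<dots> < card X" using cardX \<open>card S > 0\<close> by simp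
      finally show ?thesis by (intro lagrange_partial_fractions X tS)
    qed
    also have "- \<dots> = (\<Sum>x\<in>Z. 1 / (x - t) * m' x)"
      unfolding sum_m' sum_negf[symmetric]
      by (intro sum.cong refl) (simp add: flip[of "\<lambda>_. 1" _ t])
    finally show ?thesis by simp
  qed
  then have m: "m x = m' x" if "x \<in> Z" for x
    using partial_fractions_unique[OF Z] that by blast
  have "(\<Sum>x\<in>Z. g x * m x) = div_diff X (\<lambda>t. g t * (poly q1 t)\<^sup>2) + div_diff X (\<lambda>t. g t * (poly q2 t)\<^sup>2)" for g
  proof -
    have "(\<Sum>x\<in>Z. g x * m x) = (\<Sum>x\<in>Z. g x * m' x)" using m by (intro sum.cong) auto
    also have "\<dots> = div_diff X (\<lambda>t. g t * (poly q1 t)\<^sup>2 + g t * (poly q2 t)\<^sup>2)"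
      unfolding sum_m' div_diff_def by (simp add: G_def distrib_left)
    finally show ?thesis by (simp only: div_diff_add)
  qed
  then show ?thesis using that[of X q1 q2] X cardX deg unfolding S_def by blast
qed

section \<open>Monotonicity under rank-one perturbations\<close>

text \<open>This is \<open>(P\<^sub>z x, y)\<close> for the spectral projection \<open>P\<^sub>z\<close> of \<open>spectral_mat n U d\<close> at \<open>z\<close>. Summing over
  all \<open>i\<close> with \<open>d i = z\<close> takes care of repeated eigenvalues.\<close>
definition spectral_weight ::
  "nat \<Rightarrow> complex mat \<Rightarrow> (nat \<Rightarrow> real) \<Rightarrow> complex Matrix.vec \<Rightarrow> complex Matrix.vec \<Rightarrow> real \<Rightarrow> complex" where
  "spectral_weight n U d x y z
    = (\<Sum>i\<in>{i. i < n \<and> d i = z}. (mat_adjoint U *\<^sub>v x) $ i * cnj ((mat_adjoint U *\<^sub>v y) $ i))"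

lemma spectral_mat_form_weight:
  assumes U: "U \<in> carrier_mat n n" and x: "x \<in> carrier_vec n" and y: "y \<in> carrier_vec n"
    and Z: "finite Z" "d ` {..<n} \<subseteq> Z"
  shows "(spectral_mat n U (\<lambda>i. g (d i)) *\<^sub>v x) \<bullet>c y = (\<Sum>z\<in>Z. of_real (g z) * spectral_weight n U d x y z)"
proof -
  let ?h = "\<lambda>i. (mat_adjoint U *\<^sub>v x) $ i * cnj ((mat_adjoint U *\<^sub>v y) $ i)"
  have "(\<Sum>z\<in>Z. of_real (g z) * spectral_weight n U d x y z)
      = (\<Sum>z\<in>Z. \<Sum>i\<in>{i. i \<in> {..<n} \<and> d i = z}. of_real (g (d i)) * ?h i)"
    unfolding spectral_weight_def sum_distrib_left by (intro sum.cong) auto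
  also have "\<dots> = (\<Sum>i<n. of_real (g (d i)) * ?h i)"
    using Z by (intro sum.group) auto
  finally show ?thesis
    unfolding spectral_mat_form[OF U x y] by (simp add: mult.assoc)
qed

lemma spectral_weight_cnj: "spectral_weight n U d y x z = cnj (spectral_weight n U d x y z)"
  by (simp add: spectral_weight_def mult.commute)

lemma spectral_weight_self:
  "spectral_weight n U d x x z
    = of_real (\<Sum>i\<in>{i. i < n \<and> d i = z}. (cmod ((mat_adjoint U *\<^sub>v x) $ i))\<^sup>2)"
  by (simp add: spectral_weight_def complex_norm_square del: of_real_power)

lemma spectral_weight_self_real: "of_real (Re (spectral_weight n U d x x z)) = spectral_weight n U d x x z"
  by (simp add: spectral_weight_self)

text \<open>\<open>(P\<^sub>z x, x)\<close> is the square of the norm of \<open>P\<^sub>z x\<close>, so that \<open>P\<^sub>z x = 0\<close>, and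
  \<open>(P\<^sub>z y, x) = (y, P\<^sub>z x)\<close>.\<close>
lemma spectral_weight_eq_0:
  assumes "Re (spectral_weight n U d x x z) = 0"
  shows "spectral_weight n U d y x z = 0"
proof -
  have "(mat_adjoint U *\<^sub>v x) $ i = 0" if "i < n" "d i = z" for i
  proof -
    have "(\<Sum>i\<in>{i. i < n \<and> d i = z}. (cmod ((mat_adjoint U *\<^sub>v x) $ i))\<^sup>2) = 0"
      using assms by (simp add: spectral_weight_self)
    then show ?thesis using that by (subst (asm) sum_nonneg_eq_0_iff) auto
  qed
  then show ?thesis by (simp add: spectral_weight_def)
qed

lemma spectral_weight_eq_0_outside:
  assumes "z \<notin> d ` {..<n}"
  shows "spectral_weight n U d x y z = 0"
  using assms by (auto simp: spectral_weight_def intro!: sum.neutral)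

lemma spectral_mat_form_self:
  assumes U: "U \<in> carrier_mat n n" and x: "x \<in> carrier_vec n"
  shows "(spectral_mat n U g *\<^sub>v x) \<bullet>c x = of_real (\<Sum>i<n. g i * (cmod ((mat_adjoint U *\<^sub>v x) $ i))\<^sup>2)"
  unfolding spectral_mat_form[OF U x x] of_real_sum
  by (intro sum.cong refl) (simp add: complex_norm_square mult.assoc del: of_real_power)

lemma spectral_mat_self_adjoint:
  assumes "U \<in> carrier_mat n n" "x \<in> carrier_vec n" "y \<in> carrier_vec n"
  shows "(spectral_mat n U g *\<^sub>v x) \<bullet>c y = x \<bullet>c (spectral_mat n U g *\<^sub>v y)"
  using cscalar_prod_adjoint[of "spectral_mat n U g" n n x y] hermitian_spectral_mat[OF assms(1), of g] assms
  by (simp add: hermitian_mat_def)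

text \<open>\<open>A (A - t)\<inverse> = 1 + t (A - t)\<inverse>\<close>, tested against a vector.\<close>
lemma spectral_mat_resolvent_form:
  assumes U: "unitary_mat n U" and x: "x \<in> carrier_vec n" and y: "y \<in> carrier_vec n"
    and t: "t \<notin> d ` {..<n}"
  defines "R \<equiv> spectral_mat n U (\<lambda>i. 1 / (d i - t))"
  shows "(spectral_mat n U d *\<^sub>v (R *\<^sub>v x)) \<bullet>c y = x \<bullet>c y + of_real t * ((R *\<^sub>v x) \<bullet>c y)"
proof -
  note u = unitary_matD[OF U]
  let ?h = "\<lambda>i. (mat_adjoint U *\<^sub>v x) $ i * cnj ((mat_adjoint U *\<^sub>v y) $ i)"
  have "spectral_mat n U d *\<^sub>v (R *\<^sub>v x) = spectral_mat n U (\<lambda>i. d i * (1 / (d i - t))) *\<^sub>v x"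
    using x u by (simp add: R_def assoc_mult_mat_vec[of _ n n _ n, symmetric] spectral_mat_mult[OF U])
  moreover have "x \<bullet>c y = (\<Sum>i<n. ?h i)"
    using spectral_mat_form[OF u(1) x y, of "\<lambda>i. 1"] x by (simp add: spectral_mat_one[OF U])
  moreover have "of_real (d i * (1 / (d i - t))) * ?h i = ?h i + of_real t * (of_real (1 / (d i - t)) * ?h i)"
    if "i < n" for i
  proof -
    have "d i - t \<noteq> 0" using t that by auto
    then have "d i * (1 / (d i - t)) = 1 + t * (1 / (d i - t))" by (simp add: field_simps)
    then show ?thesis by (simp add: distrib_right mult.assoc)
  qed
  ultimately show ?thesis
    by (simp add: R_def spectral_mat_form[OF u(1) x y] mult.assoc sum.distrib sum_distrib_left)
qed

lemma cnj_cscalar_prod: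
  assumes "x \<in> carrier_vec n" "y \<in> carrier_vec n"
  shows "cnj (x \<bullet>c y) = y \<bullet>c (x :: complex Matrix.vec)"
  using assms by (simp add: scalar_prod_def mult.commute)

text \<open>The second resolvent identity \<open>T = R - T (B - A) R\<close> for the resolvents \<open>R\<close> of \<open>A\<close> and \<open>T\<close> of \<open>B\<close>,
  with the rank-one form inserted for \<open>B - A\<close>. It comes from evaluating the forms of \<open>A\<close> and of \<open>B\<close>
  at \<open>R x\<close> and \<open>T y\<close>.\<close>
lemma rank_one_resolvent:
  assumes U: "unitary_mat n U" and V: "unitary_mat n V" and v: "v \<in> carrier_vec n"
    and rank1: "\<And>x y. x \<in> carrier_vec n \<Longrightarrow> y \<in> carrier_vec n \<Longrightarrow>
      (spectral_mat n V e *\<^sub>v x) \<bullet>c y = (spectral_mat n U d *\<^sub>v x) \<bullet>c y + (x \<bullet>c v) * cnj (y \<bullet>c v)"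
    and t: "t \<notin> d ` {..<n}" "t \<notin> e ` {..<n}"
    and x: "x \<in> carrier_vec n" and y: "y \<in> carrier_vec n"
  defines "R \<equiv> spectral_mat n U (\<lambda>i. 1 / (d i - t))" and "T \<equiv> spectral_mat n V (\<lambda>i. 1 / (e i - t))"
  shows "(T *\<^sub>v x) \<bullet>c y = (R *\<^sub>v x) \<bullet>c y - ((R *\<^sub>v x) \<bullet>c v) * ((T *\<^sub>v v) \<bullet>c y)"
proof -
  note u = unitary_matD[OF U] and v' = unitary_matD[OF V]
  let ?x = "R *\<^sub>v x" and ?y = "T *\<^sub>v y"
  have R: "R \<in> carrier_mat n n" and T: "T \<in> carrier_mat n n"
    using u v' by (simp_all add: R_def T_def)
  have car: "?x \<in> carrier_vec n" "?y \<in> carrier_vec n"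
    using R T x y by (simp_all add: mult_mat_vec_carrier[of _ n n])
  have sB: "spectral_mat n V e \<in> carrier_mat n n" using v' by simp
  have Bxy: "(spectral_mat n V e *\<^sub>v ?x) \<bullet>c ?y = ?x \<bullet>c y + of_real t * (?x \<bullet>c ?y)"
  proof -
    have "(spectral_mat n V e *\<^sub>v ?x) \<bullet>c ?y = ?x \<bullet>c (spectral_mat n V e *\<^sub>v ?y)"
      by (rule spectral_mat_self_adjoint[OF v'(1) car])
    also have "\<dots> = cnj ((spectral_mat n V e *\<^sub>v ?y) \<bullet>c ?x)"
      by (rule cnj_cscalar_prod[OF mult_mat_vec_carrier[OF sB car(2)] car(1), symmetric])
    also have "(spectral_mat n V e *\<^sub>v ?y) \<bullet>c ?x = y \<bullet>c ?x + of_real t * (?y \<bullet>c ?x)"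
      unfolding T_def by (rule spectral_mat_resolvent_form[OF V y car(1) t(2)])
    finally show ?thesis
      by (simp only: complex_cnj_add complex_cnj_mult complex_cnj_complex_of_real
          cnj_cscalar_prod[OF y car(1)] cnj_cscalar_prod[OF car(2,1)])
  qed
  have Axy: "(spectral_mat n U d *\<^sub>v ?x) \<bullet>c ?y = x \<bullet>c ?y + of_real t * (?x \<bullet>c ?y)"
    unfolding R_def by (rule spectral_mat_resolvent_form[OF U x car(2) t(1)])
  have "x \<bullet>c ?y = (T *\<^sub>v x) \<bullet>c y"
    unfolding T_def by (rule spectral_mat_self_adjoint[OF v'(1) x y, symmetric])
  moreover have "cnj (?y \<bullet>c v) = (T *\<^sub>v v) \<bullet>c y"
  proof -
    have "cnj (?y \<bullet>c v) = v \<bullet>c ?y" by (rule cnj_cscalar_prod[OF car(2) v])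
    then show ?thesis unfolding T_def using spectral_mat_self_adjoint[OF v'(1) v y] by simp
  qed
  ultimately show ?thesis
    using rank1[OF car] Axy Bxy by simp
qed

text \<open>The resolvent identity for the pairs \<open>(v, v)\<close>, \<open>(w, w)\<close>, \<open>(v, w)\<close> supplies the two hypotheses of
  \<open>rank_one_weights_div_diff\<close>. The number \<open>k\<close> of the eigenvalues of \<open>A\<close> that are seen by \<open>v\<close> is at
  most \<open>n\<close>.\<close>
lemma rank_one_monotone:
  assumes U: "unitary_mat n U" and V: "unitary_mat n V" and v: "v \<in> carrier_vec n"
    and rank1: "\<And>x y. x \<in> carrier_vec n \<Longrightarrow> y \<in> carrier_vec n \<Longrightarrow>
      (spectral_mat n V e *\<^sub>v x) \<bullet>c y = (spectral_mat n U d *\<^sub>v x) \<bullet>c y + (x \<bullet>c v) * cnj (y \<bullet>c v)"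
    and I: "d ` {..<n} \<subseteq> I" "e ` {..<n} \<subseteq> I" "open I" "I \<noteq> {}"
    and f: "square_positive n I f" and w: "w \<in> carrier_vec n"
  shows "(spectral_mat n U (\<lambda>i. f (d i)) *\<^sub>v w) \<bullet>c w \<le> (spectral_mat n V (\<lambda>i. f (e i)) *\<^sub>v w) \<bullet>c w"
proof -
  note u = unitary_matD[OF U] and v' = unitary_matD[OF V]
  define Z where "Z = d ` {..<n} \<union> e ` {..<n}"
  have Z: "finite Z" "d ` {..<n} \<subseteq> Z" "e ` {..<n} \<subseteq> Z" by (auto simp: Z_def)
  define a b where "a = spectral_weight n U d" and "b = spectral_weight n V e"
  define \<alpha> \<beta> where "\<alpha> z = Re (a v v z)" and "\<beta> z = Re (b v v z)" for z
  define c1 c2 where "c1 z = Re (a w v z)" and "c2 z = Im (a w v z)" for z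
  define m where "m z = Re (b w w z) - Re (a w w z)" for z
  have real: "of_real (Re (a x x z)) = a x x z" "of_real (Re (b x x z)) = b x x z" for x z
    by (simp_all only: a_def b_def spectral_weight_self_real)
  define R where "R t = spectral_mat n U (\<lambda>i. 1 / (d i - t))" for t
  define T where "T t = spectral_mat n V (\<lambda>i. 1 / (e i - t))" for t
  have R: "(R t *\<^sub>v x) \<bullet>c y = (\<Sum>z\<in>Z. of_real (1 / (z - t)) * a x y z)"
    if "x \<in> carrier_vec n" "y \<in> carrier_vec n" for x y t
    unfolding R_def a_def using spectral_mat_form_weight[OF u(1) that Z(1,2), of "\<lambda>z. 1 / (z - t)"] .
  have T: "(T t *\<^sub>v x) \<bullet>c y = (\<Sum>z\<in>Z. of_real (1 / (z - t)) * b x y z)"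
    if "x \<in> carrier_vec n" "y \<in> carrier_vec n" for x y t
    unfolding T_def b_def using spectral_mat_form_weight[OF v'(1) that Z(1,3), of "\<lambda>z. 1 / (z - t)"] .
  have res: "(T t *\<^sub>v x) \<bullet>c y = (R t *\<^sub>v x) \<bullet>c y - ((R t *\<^sub>v x) \<bullet>c v) * ((T t *\<^sub>v v) \<bullet>c y)"
    if "t \<notin> Z" "x \<in> carrier_vec n" "y \<in> carrier_vec n" for t x y
    unfolding R_def T_def
    by (rule rank_one_resolvent[OF U V v rank1]) (use that in \<open>auto simp: Z_def\<close>)
  have Rvv: "(R t *\<^sub>v v) \<bullet>c v = of_real (\<Sum>z\<in>Z. \<alpha> z / (z - t))" for t
    unfolding R[OF v v] of_real_sum by (intro sum.cong refl) (simp add: \<alpha>_def real)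
  have Tvv: "(T t *\<^sub>v v) \<bullet>c v = of_real (\<Sum>z\<in>Z. \<beta> z / (z - t))" for t
    unfolding T[OF v v] of_real_sum by (intro sum.cong refl) (simp add: \<beta>_def real)
  have Rwv: "(R t *\<^sub>v w) \<bullet>c v = Complex (\<Sum>z\<in>Z. c1 z / (z - t)) (\<Sum>z\<in>Z. c2 z / (z - t))" for t
    unfolding R[OF w v] by (simp add: complex_eq_iff c1_def c2_def)
  have Rvw: "(R t *\<^sub>v v) \<bullet>c w = cnj ((R t *\<^sub>v w) \<bullet>c v)" for t
    unfolding R[OF w v] R[OF v w] by (simp add: a_def spectral_weight_cnj[of n U d v w])
  have TRww: "(T t *\<^sub>v w) \<bullet>c w - (R t *\<^sub>v w) \<bullet>c w = of_real (\<Sum>z\<in>Z. m z / (z - t))" for t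
    unfolding T[OF w w] R[OF w w] of_real_sum sum_subtractf[symmetric]
    by (intro sum.cong refl) (simp add: m_def real diff_divide_distrib)
  have alg1: "(1 + r) * (1 - s) = 1" if "s = r - r * s" for r s :: complex
  proof -
    have "(1 + r) * (1 - s) = 1 + ((r - r * s) - s)" by (simp add: algebra_simps)
    then show ?thesis using that by simp
  qed
  have alg2: "(q - p) * (1 + r) = - (g * h)" if "q = p - g * s" "s = h - r * s" for p q r s g h :: complex
  proof -
    have "(q - p) * (1 + r) = - (g * (s + r * s))" by (simp add: that(1) algebra_simps)
    also have "s + r * s = h" using that(2) by (simp add: eq_diff_eq)
    finally show ?thesis .
  qed
  have recip: "(1 + (\<Sum>x\<in>Z. \<alpha> x / (x - t))) * (1 - (\<Sum>x\<in>Z. \<beta> x / (x - t))) = 1" if "t \<notin> Z" for t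
  proof -
    have "complex_of_real ((1 + (\<Sum>x\<in>Z. \<alpha> x / (x - t))) * (1 - (\<Sum>x\<in>Z. \<beta> x / (x - t)))) = 1"
      unfolding of_real_mult of_real_add of_real_diff Rvv[symmetric] Tvv[symmetric] of_real_1
      by (rule alg1[OF res[OF that v v]])
    then show ?thesis using of_real_eq_1_iff by blast
  qed
  have diff: "(\<Sum>x\<in>Z. m x / (x - t)) * (1 + (\<Sum>x\<in>Z. \<alpha> x / (x - t)))
      = - ((\<Sum>x\<in>Z. c1 x / (x - t))\<^sup>2 + (\<Sum>x\<in>Z. c2 x / (x - t))\<^sup>2)" if "t \<notin> Z" for t
  proof -
    have "((T t *\<^sub>v w) \<bullet>c w - (R t *\<^sub>v w) \<bullet>c w) * (1 + (R t *\<^sub>v v) \<bullet>c v)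
        = - (((R t *\<^sub>v w) \<bullet>c v) * ((R t *\<^sub>v v) \<bullet>c w))"
      by (rule alg2[OF res[OF that w w] res[OF that v w]])
    also have "\<dots> = - of_real ((\<Sum>x\<in>Z. c1 x / (x - t))\<^sup>2 + (\<Sum>x\<in>Z. c2 x / (x - t))\<^sup>2)"
      unfolding Rvw Rwv complex_mult_cnj by simp
    finally have "complex_of_real ((\<Sum>x\<in>Z. m x / (x - t)) * (1 + (\<Sum>x\<in>Z. \<alpha> x / (x - t))))
      = of_real (- ((\<Sum>x\<in>Z. c1 x / (x - t))\<^sup>2 + (\<Sum>x\<in>Z. c2 x / (x - t))\<^sup>2))"
      unfolding TRww Rvv by simp
    then show ?thesis using of_real_eq_iff by blast
  qed
  have c0: "c1 z = 0" "c2 z = 0" if "\<alpha> z = 0" for z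
    using spectral_weight_eq_0[of n U d v z w] that by (simp_all add: \<alpha>_def a_def c1_def c2_def)
  define k where "k = card {z \<in> Z. \<alpha> z \<noteq> 0}"
  obtain X q1 q2 where X: "X \<subseteq> Z" "card X = 2 * k" and deg: "degree q1 \<le> k - 1" "degree q2 \<le> k - 1"
    and sum: "\<And>g. (\<Sum>x\<in>Z. g x * m x)
      = div_diff X (\<lambda>t. g t * (poly q1 t)\<^sup>2) + div_diff X (\<lambda>t. g t * (poly q2 t)\<^sup>2)"
    by (rule rank_one_weights_div_diff[OF Z(1) c0 recip diff, folded k_def]; (assumption | (rule that; assumption)))
  have "{z \<in> Z. \<alpha> z \<noteq> 0} \<subseteq> d ` {..<n}"
    by (rule subsetI, rule ccontr) (simp add: \<alpha>_def a_def spectral_weight_eq_0_outside)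
  then have "k \<le> card (d ` {..<n})" unfolding k_def by (intro card_mono) auto
  also have "\<dots> \<le> n" using card_image_le[of "{..<n}" d] by simp
  finally have "square_positive k I f" using square_positive_mono f I by blast
  then have pos: "0 \<le> div_diff X (\<lambda>t. f t * (poly q t)\<^sup>2)" if "degree q \<le> k - 1" for q
  proof -
    have "X \<subseteq> I" using X(1) I(1,2) by (auto simp: Z_def)
    then show ?thesis
      using square_positiveD[OF \<open>square_positive k I f\<close> finite_subset[OF X(1) Z(1)] _ X(2) that] by simp
  qed
  have "(spectral_mat n V (\<lambda>i. f (e i)) *\<^sub>v w) \<bullet>c w - (spectral_mat n U (\<lambda>i. f (d i)) *\<^sub>v w) \<bullet>c w
      = of_real (\<Sum>z\<in>Z. f z * m z)"
    unfolding spectral_mat_form_weight[OF v'(1) w w Z(1,3)] spectral_mat_form_weight[OF u(1) w w Z(1,2)]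
      of_real_sum sum_subtractf[symmetric]
    by (intro sum.cong refl) (simp add: m_def real a_def b_def right_diff_distrib spectral_weight_self_real)
  moreover have "0 \<le> (\<Sum>z\<in>Z. f z * m z)" unfolding sum using pos deg by (intro add_nonneg_nonneg) auto
  ultimately have "0 \<le> (spectral_mat n V (\<lambda>i. f (e i)) *\<^sub>v w) \<bullet>c w - (spectral_mat n U (\<lambda>i. f (d i)) *\<^sub>v w) \<bullet>c w"
    by (simp add: less_eq_complex_def)
  then show ?thesis by (simp add: less_eq_complex_def)
qed

section \<open>From rank one to the Loewner order\<close>

lemma loewner_leD:
  assumes "loewner_le n A B" "x \<in> carrier_vec n"
  shows "(A *\<^sub>v x) \<bullet>c x \<le> (B *\<^sub>v x) \<bullet>c x"
proof -
  have A: "A \<in> carrier_mat n n" and B: "B \<in> carrier_mat n n"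
    and pos: "0 \<le> ((B - A) *\<^sub>v x) \<bullet>c x"
    using assms by (auto simp: loewner_le_def psd_mat_def)
  have "((B - A) *\<^sub>v x) \<bullet>c x = (B *\<^sub>v x) \<bullet>c x - (A *\<^sub>v x) \<bullet>c x"
    using A B assms(2) by (simp add: minus_mult_distrib_mat_vec[of _ n n] minus_scalar_prod_distrib[of _ n])
  then show ?thesis using pos by (simp add: less_eq_complex_def)
qed

lemma loewner_leI:
  assumes A: "hermitian_mat n A" and B: "hermitian_mat n B"
    and le: "\<And>x. x \<in> carrier_vec n \<Longrightarrow> (A *\<^sub>v x) \<bullet>c x \<le> (B *\<^sub>v x) \<bullet>c x"
  shows "loewner_le n A B"
proof -
  note car = hermitian_matD(1)[OF A] hermitian_matD(1)[OF B]
  have "0 \<le> ((B - A) *\<^sub>v x) \<bullet>c x" if x: "x \<in> carrier_vec n" for x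
  proof -
    have "((B - A) *\<^sub>v x) \<bullet>c x = (B *\<^sub>v x) \<bullet>c x - (A *\<^sub>v x) \<bullet>c x"
      using car x by (simp add: minus_mult_distrib_mat_vec[of _ n n] minus_scalar_prod_distrib[of _ n])
    then show ?thesis using le[OF x] by (simp add: less_eq_complex_def)
  qed
  moreover have "hermitian_mat n (B - A)"
  proof (rule hermitian_matI)
    show "B - A \<in> carrier_mat n n" using car(1) by (rule minus_carrier_mat)
    fix i j assume "i < n" "j < n"
    then show "(B - A) $$ (j, i) = cnj ((B - A) $$ (i, j))"
      using car hermitian_matD(2)[OF A, of i j] hermitian_matD(2)[OF B, of i j] by simp
  qed
  ultimately show ?thesis using car by (simp add: loewner_le_def psd_mat_def)
qed

lemma spectral_mat_unitary_column:
  assumes W: "unitary_mat n W" and i: "i < n"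
  defines "x \<equiv> W *\<^sub>v unit_vec n i"
  shows "x \<in> carrier_vec n" "x \<bullet>c x = 1" "(spectral_mat n W g *\<^sub>v x) \<bullet>c x = of_real (g i)"
proof -
  note w = unitary_matD[OF W]
  show x: "x \<in> carrier_vec n" using w by (simp add: x_def)
  have "mat_adjoint W *\<^sub>v x = unit_vec n i"
    unfolding x_def by (rule unitary_mat_mult_vec_cancel(2)[OF W]) simp
  then have form: "(spectral_mat n W h *\<^sub>v x) \<bullet>c x = of_real (h i)" for h
  proof -
    have "(\<Sum>j<n. h j * (cmod (unit_vec n i $ j))\<^sup>2) = (\<Sum>j<n. if j = i then h j else 0)"
      by (intro sum.cong) (auto simp: unit_vec_def)
    then show ?thesis
      using i unfolding spectral_mat_form_self[OF w(1) x] \<open>mat_adjoint W *\<^sub>v x = unit_vec n i\<close> by simp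
  qed
  then show "(spectral_mat n W g *\<^sub>v x) \<bullet>c x = of_real (g i)" .
  show "x \<bullet>c x = 1"
    using form[of "\<lambda>_. 1"] x by (simp add: spectral_mat_one[OF W])
qed

lemma weighted_mean_between:
  fixes d p :: "nat \<Rightarrow> real"
  assumes p: "\<And>i. i < n \<Longrightarrow> 0 \<le> p i" "(\<Sum>i<n. p i) = 1"
  obtains i j where "i < n" "d i \<le> (\<Sum>i<n. d i * p i)" "j < n" "(\<Sum>i<n. d i * p i) \<le> d j"
proof -
  define s where "s = (\<Sum>i<n. d i * p i)"
  have s: "(\<Sum>i<n. (d i - s) * p i) = 0"
    using p(2) by (simp add: left_diff_distrib sum_subtractf s_def flip: sum_distrib_left)
  have False if "\<And>i. i < n \<Longrightarrow> d i > s"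
  proof -
    have "\<forall>i\<in>{..<n}. (d i - s) * p i = 0"
      using s p(1) that by (subst (asm) sum_nonneg_eq_0_iff) (auto simp: less_imp_le)
    then have "p i = 0" if "i < n" for i using \<open>\<And>i. i < n \<Longrightarrow> d i > s\<close>[OF that] that by auto
    then show False using p(2) by simp
  qed
  moreover have False if "\<And>i. i < n \<Longrightarrow> d i < s"
  proof -
    have "(\<Sum>i<n. (s - d i) * p i) = 0"
      using s by (simp add: left_diff_distrib sum_subtractf)
    then have "\<forall>i\<in>{..<n}. (s - d i) * p i = 0"
      using p(1) that by (subst (asm) sum_nonneg_eq_0_iff) (auto simp: less_imp_le)
    then have "p i = 0" if "i < n" for i using \<open>\<And>i. i < n \<Longrightarrow> d i < s\<close>[OF that] that by auto
    then show False using p(2) by simp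
  qed
  ultimately show ?thesis using that unfolding s_def by (meson linorder_not_le)
qed

text \<open>The form at a unit vector is a mean of the eigenvalues, with the weights \<open>\<bar>(U\<^sup>* x)\<^sub>i\<bar>\<^sup>2\<close>.\<close>
lemma spectral_mat_form_between:
  assumes U: "unitary_mat n U" and x: "x \<in> carrier_vec n" "x \<bullet>c x = 1"
  obtains i j where "i < n" "of_real (d i) \<le> (spectral_mat n U d *\<^sub>v x) \<bullet>c x"
    "j < n" "(spectral_mat n U d *\<^sub>v x) \<bullet>c x \<le> of_real (d j)"
proof -
  note u = unitary_matD[OF U]
  define p where "p i = (cmod ((mat_adjoint U *\<^sub>v x) $ i))\<^sup>2" for i
  have form: "(spectral_mat n U h *\<^sub>v x) \<bullet>c x = of_real (\<Sum>i<n. h i * p i)" for h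
    unfolding p_def by (rule spectral_mat_form_self[OF u(1) x(1)])
  have "(\<Sum>i<n. p i) = 1"
    using form[of "\<lambda>_. 1"] x by (simp add: spectral_mat_one[OF U] flip: of_real_sum)
  then obtain i j where "i < n" "d i \<le> (\<Sum>i<n. d i * p i)" "j < n" "(\<Sum>i<n. d i * p i) \<le> d j"
    using weighted_mean_between[of n p d] by (auto simp: p_def)
  then show ?thesis using that[of i j] unfolding form by (simp add: less_eq_complex_def)
qed

text \<open>An eigenvalue in the middle is the value of the form at a unit eigenvector, so it lies above some
  eigenvalue of the smaller and below some eigenvalue of the larger matrix.\<close>
lemma eigenvalues_between:
  assumes U: "unitary_mat n U" and V: "unitary_mat n V" and W: "unitary_mat n W"
    and le1: "\<And>x. x \<in> carrier_vec n \<Longrightarrow> (spectral_mat n U d *\<^sub>v x) \<bullet>c x \<le> (spectral_mat n W g *\<^sub>v x) \<bullet>c x"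
    and le2: "\<And>x. x \<in> carrier_vec n \<Longrightarrow> (spectral_mat n W g *\<^sub>v x) \<bullet>c x \<le> (spectral_mat n V e *\<^sub>v x) \<bullet>c x"
    and I: "is_interval I" "d ` {..<n} \<subseteq> I" "e ` {..<n} \<subseteq> I"
  shows "g ` {..<n} \<subseteq> I"
proof
  fix r assume "r \<in> g ` {..<n}"
  then obtain k where k: "k < n" "r = g k" by auto
  define x where "x = W *\<^sub>v unit_vec n k"
  note x = spectral_mat_unitary_column[OF W k(1), folded x_def]
  obtain i where i: "i < n" "of_real (d i) \<le> (spectral_mat n U d *\<^sub>v x) \<bullet>c x"
    by (rule spectral_mat_form_between[OF U x(1,2)])
  obtain j where j: "j < n" "(spectral_mat n V e *\<^sub>v x) \<bullet>c x \<le> of_real (e j)"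
    by (rule spectral_mat_form_between[OF V x(1,2)])
  have "complex_of_real (d i) \<le> of_real r" "complex_of_real r \<le> of_real (e j)"
    using order.trans[OF i(2) le1[OF x(1)]] order.trans[OF le2[OF x(1)] j(2)] k by (simp_all add: x(3))
  then have "d i \<le> r" "r \<le> e j" by (simp_all add: less_eq_complex_def)
  then show "r \<in> I" using i(1) j(1) I mem_is_interval_1_I[OF I(1), of "d i" "e j" r] by auto
qed

text \<open>Diagonalize \<open>B - A = W diag(\<delta>) W\<^sup>*\<close> with \<open>\<delta> \<ge> 0\<close> and switch on the eigenvalues \<open>\<delta> 0\<close>, \<open>\<delta> 1\<close>,
  \<open>\<dots>\<close> one at a time. The resulting chain \<open>C 0 = A\<close>, \<open>\<dots>\<close>, \<open>C n = B\<close> increases by rank-one steps,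
  and the eigenvalues of its members remain in the interval \<open>I\<close>.\<close>
lemma square_positive_imp_monotone:
  assumes U: "unitary_mat n U" and V: "unitary_mat n V"
    and I: "is_interval I" "open I" "I \<noteq> {}" "d ` {..<n} \<subseteq> I" "e ` {..<n} \<subseteq> I"
    and f: "square_positive n I f" and le: "loewner_le n (spectral_mat n U d) (spectral_mat n V e)"
    and w: "w \<in> carrier_vec n"
  shows "(spectral_mat n U (\<lambda>i. f (d i)) *\<^sub>v w) \<bullet>c w \<le> (spectral_mat n V (\<lambda>i. f (e i)) *\<^sub>v w) \<bullet>c w"
proof -
  note u = unitary_matD[OF U] and v = unitary_matD[OF V]
  let ?A = "spectral_mat n U d" and ?B = "spectral_mat n V e"
  have A: "?A \<in> carrier_mat n n" and B: "?B \<in> carrier_mat n n" using u v by simp_all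
  have psd: "psd_mat n (?B - ?A)" using le by (simp add: loewner_le_def)
  then obtain W \<delta> where W: "unitary_mat n W" and D: "?B - ?A = spectral_mat n W \<delta>"
    using spectral_theorem unfolding psd_mat_def by metis
  note w' = unitary_matD[OF W]
  have \<delta>: "0 \<le> \<delta> i" if "i < n" for i
    using psd spectral_mat_unitary_column[OF W that] unfolding D psd_mat_def
    by (metis Re_complex_of_real less_eq_complex_def zero_complex.simps(1))
  define C where "C m = ?A + spectral_mat n W (\<lambda>i. if i < m then \<delta> i else 0)" for m
  have C: "C m \<in> carrier_mat n n" for m using A w' by (simp add: C_def)
  have form: "(C m *\<^sub>v x) \<bullet>c y = (?A *\<^sub>v x) \<bullet>c y
      + (\<Sum>i<n. of_real (if i < m then \<delta> i else 0) * (mat_adjoint W *\<^sub>v x) $ i * cnj ((mat_adjoint W *\<^sub>v y) $ i))"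
    if "x \<in> carrier_vec n" "y \<in> carrier_vec n" for m x y
  proof -
    have car: "spectral_mat n W (\<lambda>i. if i < m then \<delta> i else 0) \<in> carrier_mat n n" using w' by simp
    have "C m *\<^sub>v x = ?A *\<^sub>v x + spectral_mat n W (\<lambda>i. if i < m then \<delta> i else 0) *\<^sub>v x"
      unfolding C_def using A car that(1) by (rule add_mult_distrib_mat_vec)
    then show ?thesis
      using mult_mat_vec_carrier[OF A that(1)] mult_mat_vec_carrier[OF car that(1)] that
      by (simp only: add_scalar_prod_distrib[of _ n _ "conjugate y"] carrier_vec_conjugate
          spectral_mat_form[OF w'(1) that])
  qed
  have herm: "hermitian_mat n (C m)" for m
  proof (rule hermitian_matI[OF C])
    fix i j assume ij: "i < n" "j < n"
    then show "C m $$ (j, i) = cnj (C m $$ (i, j))"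
      using hermitian_matD(2)[OF hermitian_spectral_mat[OF u(1), of d], of i j] w' u
        hermitian_matD(2)[OF hermitian_spectral_mat[OF w'(1), of "\<lambda>i. if i < m then \<delta> i else 0"], of i j]
      by (simp add: C_def)
  qed
  have mono: "(C m *\<^sub>v x) \<bullet>c x \<le> (C m' *\<^sub>v x) \<bullet>c x" if "m \<le> m'" "x \<in> carrier_vec n" for m m' x
    unfolding form[OF that(2,2)] using \<delta> that(1)
    by (intro add_left_mono sum_mono)
      (auto simp: mult.assoc complex_norm_square[symmetric] less_eq_complex_def simp del: of_real_power)
  have C0: "C 0 = ?A"
    by (rule eq_matI) (use u w' in \<open>auto simp: C_def spectral_mat_index\<close>)
  have "C n = ?A + (?B - ?A)"
    unfolding D C_def using w' by (intro arg_cong2[of _ _ _ _ "(+)"] eq_matI) (auto simp: spectral_mat_index)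
  also have "\<dots> = ?B"
    by (rule eq_matI) (use u v in auto)
  finally have Cn: "C n = ?B" .
  have "\<exists>V e. unitary_mat n V \<and> C m = spectral_mat n V e" for m
    using spectral_theorem[OF herm[of m]] by metis
  then obtain Vs es where Vs: "\<And>m. unitary_mat n (Vs m)" and es: "\<And>m. C m = spectral_mat n (Vs m) (es m)"
    by metis
  have sub: "es m ` {..<n} \<subseteq> I" if "m \<le> n" for m
    by (rule eigenvalues_between[OF U V Vs[of m] _ _ I(1,4,5)])
      (use mono[of 0 m] mono[of m n] that in \<open>auto simp: C0 Cn es[symmetric]\<close>)
  let ?F = "\<lambda>m. (spectral_mat n (Vs m) (\<lambda>i. f (es m i)) *\<^sub>v w) \<bullet>c w"
  have step: "?F m \<le> ?F (Suc m)" if m: "m < n" for m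
  proof -
    define z where "z = of_real (sqrt (\<delta> m)) \<cdot>\<^sub>v col W m"
    have zc: "z \<in> carrier_vec n"
      unfolding z_def by (intro smult_carrier_vec[THEN iffD2] col_carrier_vec[OF m w'(1)])
    have rank1: "(spectral_mat n (Vs (Suc m)) (es (Suc m)) *\<^sub>v x) \<bullet>c y
        = (spectral_mat n (Vs m) (es m) *\<^sub>v x) \<bullet>c y + (x \<bullet>c z) * cnj (y \<bullet>c z)"
      if xy: "x \<in> carrier_vec n" "y \<in> carrier_vec n" for x y
    proof -
      have z: "x \<bullet>c z = of_real (sqrt (\<delta> m)) * (mat_adjoint W *\<^sub>v x) $ m" if "x \<in> carrier_vec n" for x
        using that w'(1) m
        by (simp add: z_def scalar_prod_def sum_distrib_left ac_simps)
      have "(\<Sum>i<n. of_real (if i < Suc m then \<delta> i else 0) * (mat_adjoint W *\<^sub>v x) $ i * cnj ((mat_adjoint W *\<^sub>v y) $ i))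
        = (\<Sum>i<n. of_real (if i < m then \<delta> i else 0) * (mat_adjoint W *\<^sub>v x) $ i * cnj ((mat_adjoint W *\<^sub>v y) $ i)
            + (if i = m then of_real (\<delta> i) * (mat_adjoint W *\<^sub>v x) $ i * cnj ((mat_adjoint W *\<^sub>v y) $ i) else 0))"
        by (intro sum.cong) auto
      also have "\<dots> = (\<Sum>i<n. of_real (if i < m then \<delta> i else 0) * (mat_adjoint W *\<^sub>v x) $ i * cnj ((mat_adjoint W *\<^sub>v y) $ i))
            + of_real (\<delta> m) * (mat_adjoint W *\<^sub>v x) $ m * cnj ((mat_adjoint W *\<^sub>v y) $ m)"
        using m by (simp add: sum.distrib)
      also have "of_real (\<delta> m) * (mat_adjoint W *\<^sub>v x) $ m * cnj ((mat_adjoint W *\<^sub>v y) $ m) = (x \<bullet>c z) * cnj (y \<bullet>c z)"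
      proof -
        have "of_real (\<delta> m) = complex_of_real (sqrt (\<delta> m)) * of_real (sqrt (\<delta> m))"
          using \<delta>[OF m] by (simp flip: of_real_mult)
        then show ?thesis unfolding z[OF xy(1)] z[OF xy(2)] by (simp add: ac_simps)
      qed
      finally show ?thesis unfolding es[symmetric] form[OF xy] by (simp only: add.assoc)
    qed
    show ?thesis
      using sub[of m] sub[of "Suc m"] m I(2,3) f w
      by (intro rank_one_monotone[OF Vs Vs zc rank1]) simp_all
  qed
  have "?F 0 \<le> ?F m" if "m \<le> n" for m
    using that
  proof (induction m)
    case (Suc m)
    then show ?case using step[of m] by (auto intro: order.trans)
  qed simp
  then have "?F 0 \<le> ?F n" by simp
  moreover have "spectral_mat n (Vs 0) (\<lambda>i. f (es 0 i)) = spectral_mat n U (\<lambda>i. f (d i))"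
    using fun_calc_spectral_mat[OF Vs, of f 0 "es 0"] fun_calc_spectral_mat[OF U, of f d] C0 es[of 0] by simp
  moreover have "spectral_mat n (Vs n) (\<lambda>i. f (es n i)) = spectral_mat n V (\<lambda>i. f (e i))"
    using fun_calc_spectral_mat[OF Vs, of f n "es n"] fun_calc_spectral_mat[OF V, of f e] Cn es[of n] by simp
  ultimately show ?thesis by simp
qed

lemma spectrum_subset_iff:
  assumes "unitary_mat n U"
  shows "spectrum (spectral_mat n U d) \<subseteq> complex_of_real ` I \<longleftrightarrow> d ` {..<n} \<subseteq> I"
  unfolding spectrum_spectral_mat[OF assms] by (auto simp: image_subset_iff)

theorem square_positive_imp_n_monotone:
  assumes "a < b" and f: "square_positive n (einterval a b) f"
  shows "n_monotone n a b f"
  unfolding n_monotone_def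
proof (intro allI impI)
  fix A B :: "complex mat"
  assume A: "hermitian_mat n A" and B: "hermitian_mat n B"
    and spec: "spectrum A \<subseteq> complex_of_real ` einterval a b" "spectrum B \<subseteq> complex_of_real ` einterval a b"
    and le: "loewner_le n A B"
  obtain U d where U: "unitary_mat n U" and Ad: "A = spectral_mat n U d" by (rule spectral_theorem[OF A])
  obtain V e where V: "unitary_mat n V" and Be: "B = spectral_mat n V e" by (rule spectral_theorem[OF B])
  have de: "d ` {..<n} \<subseteq> einterval a b" "e ` {..<n} \<subseteq> einterval a b"
    using spec unfolding Ad Be spectrum_subset_iff[OF U] spectrum_subset_iff[OF V] .
  have int: "is_interval (einterval a b)"
    unfolding is_interval_1 einterval_def by (auto, metis ereal_less_eq(3) less_le_trans, metis ereal_less_eq(3) le_less_trans)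
  have ne: "einterval a b \<noteq> {}" using einterval_nonempty[OF assms(1)] by blast
  show "loewner_le n (fun_calc n f A) (fun_calc n f B)"
    unfolding Ad Be fun_calc_spectral_mat[OF U] fun_calc_spectral_mat[OF V]
  proof (rule loewner_leI)
    show "hermitian_mat n (spectral_mat n U (\<lambda>i. f (d i)))" "hermitian_mat n (spectral_mat n V (\<lambda>i. f (e i)))"
      using unitary_matD(1)[OF U] unitary_matD(1)[OF V] by (simp_all add: hermitian_spectral_mat)
    show "(spectral_mat n U (\<lambda>i. f (d i)) *\<^sub>v x) \<bullet>c x \<le> (spectral_mat n V (\<lambda>i. f (e i)) *\<^sub>v x) \<bullet>c x"
      if "x \<in> carrier_vec n" for x
      using square_positive_imp_monotone[OF U V int open_einterval ne de f _ that] le Ad Be by simp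
  qed
qed

section \<open>Rank-one perturbations with prescribed interlacing spectra\<close>

text \<open>The perturbation is \<open>H = diag(l) + v v\<^sup>T\<close> with
  \<open>v\<^sub>i\<^sup>2 = - (\<Prod>j<n. l i - u j) / (\<Prod>k\<noteq>i. l i - l k)\<close>. Interlacing makes these numbers positive, and the choice
  makes \<open>1 + (\<Sum>i<n. v\<^sub>i\<^sup>2 / (l i - t))\<close> vanish at every \<open>u j\<close>. Hence \<open>(v\<^sub>i / (l i - u j))\<^sub>i\<close> is an
  eigenvector of \<open>H\<close> for \<open>u j\<close>. Each relation that is needed (the eigenvalue equation,
  orthogonality, the norms) is a sum \<open>\<Sum>i<n. p (l i) / lp i\<close> or \<open>\<Sum>i<n. p (l i) / lp i / (l i - u j)\<close>
  for a product \<open>p\<close> of factors \<open>t - u k\<close>, so that Lagrange interpolation evaluates it. The vector \<open>w\<close>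
  with coordinates \<open>q (l i) / (lp i * v\<^sub>i)\<close> interpolates \<open>q\<close>: its coordinate along the \<open>j\<close>-th
  eigenvector is a multiple of \<open>q (u j)\<close>.\<close>
lemma interlacing_rank_one:
  fixes l u :: "nat \<Rightarrow> real"
  assumes n: "n > 0"
    and lu: "\<And>i. i < n \<Longrightarrow> l i < u i" and ul: "\<And>i j. i < j \<Longrightarrow> j < n \<Longrightarrow> u i < l j"
  defines "lp i \<equiv> (\<Prod>k\<in>{..<n} - {i}. l i - l k)" and "lm i \<equiv> (\<Prod>j<n. l i - u j)"
    and "up j \<equiv> (\<Prod>k\<in>{..<n} - {j}. u j - u k)" and "um j \<equiv> (\<Prod>k<n. u j - l k)"
  obtains U :: "complex mat" where "unitary_mat n U"
    "loewner_le n (spectral_mat n (1\<^sub>m n) l) (spectral_mat n U u)"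
    "\<And>q :: real poly. degree q \<le> n - 1 \<Longrightarrow> \<exists>w \<in> carrier_vec n.
      (\<forall>i<n. (cmod (w $ i))\<^sup>2 = - ((poly q (l i))\<^sup>2 / (lp i * lm i))) \<and>
      (\<forall>j<n. (cmod ((mat_adjoint U *\<^sub>v w) $ j))\<^sup>2 = (poly q (u j))\<^sup>2 / (um j * up j))"
proof -
  have ll: "l i < l j" and uu: "u i < u j" if "i < j" "j < n" for i j
    using lu[of i] lu[of j] ul[OF that] that by linarith+
  have l_inj: "inj_on l {..<n}" and u_inj: "inj_on u {..<n}"
    by (rule linorder_inj_onI'; use ll uu in force)+
  have lu_ne: "l i \<noteq> u j" if "i < n" "j < n" for i j
    using lu[of i] ll[of i j] lu[of j] ul[of j i] that by (cases i j rule: linorder_cases) auto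
  define L where "L = l ` {..<n}"
  have L: "finite L" "card L = n" by (simp_all add: L_def card_image l_inj)
  have L_diff: "L - {l i} = l ` ({..<n} - {i})" if "i < n" for i
    using inj_on_image_set_diff[OF l_inj, of "{..<n}" "{i}"] that by (simp add: L_def)
  have prod_L: "(\<Prod>y\<in>L - {l i}. l i - y) = lp i" if "i < n" for i
    unfolding L_diff[OF that] lp_def using l_inj
    by (subst prod.reindex) (auto intro: inj_on_subset)
  have prod_L': "(\<Prod>y\<in>L. t - y) = (\<Prod>k<n. t - l k)" for t
    unfolding L_def by (simp add: prod.reindex[OF l_inj])
  have dd: "(\<Sum>i<n. poly p (l i) / lp i) = coeff p (n - 1)" if "degree p < n" for p
  proof -
    have "(\<Sum>i<n. poly p (l i) / lp i) = (\<Sum>i<n. poly p (l i) / (\<Prod>y\<in>L - {l i}. l i - y))"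
      using prod_L by (intro sum.cong) auto
    also have "\<dots> = div_diff L (poly p)"
      by (simp add: div_diff_def L_def sum.reindex[OF l_inj])
    finally show ?thesis using div_diff_poly[of L p] L that by simp
  qed
  have pf: "(\<Sum>i<n. poly p (l i) / lp i / (l i - u j)) = - (poly p (u j) / um j)"
    if "degree p < n" "j < n" for p j
  proof -
    have "u j \<notin> L" using lu_ne[of _ j] that by (force simp: L_def)
    have "(\<Sum>i<n. poly p (l i) / lp i / (l i - u j))
        = - (\<Sum>i<n. poly p (l i) / (\<Prod>y\<in>L - {l i}. l i - y) / (u j - l i))"
      unfolding sum_negf[symmetric]
    proof (rule sum.cong[OF refl])
      fix i assume "i \<in> {..<n}"
      have "c / (l i - u j) = - (c / (u j - l i))" for c by (metis minus_diff_eq minus_divide_right)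
      then show "poly p (l i) / lp i / (l i - u j) = - (poly p (l i) / (\<Prod>y\<in>L - {l i}. l i - y) / (u j - l i))"
        using prod_L \<open>i \<in> _\<close> by simp
    qed
    also have "(\<Sum>i<n. poly p (l i) / (\<Prod>y\<in>L - {l i}. l i - y) / (u j - l i))
        = (\<Sum>x\<in>L. poly p x / (\<Prod>y\<in>L - {x}. x - y) / (u j - x))"
      by (simp add: L_def sum.reindex[OF l_inj])
    also have "\<dots> = poly p (u j) / um j"
      using lagrange_partial_fractions[OF L(1) _ \<open>u j \<notin> L\<close>, of p] L(2) that
      by (simp add: prod_L' um_def)
    finally show ?thesis .
  qed
  have nz: "lp i \<noteq> 0" "lm i \<noteq> 0" "up i \<noteq> 0" "um i \<noteq> 0" if "i < n" for i
    using that l_inj u_inj lu_ne lu_ne[symmetric]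
    by (auto simp: lp_def lm_def up_def um_def prod_zero_iff inj_on_def)
  \<comment> \<open>The interpolated polynomials are \<open>P {j}\<close>, of degree \<open>n - 1\<close>, and \<open>P {j, k}\<close>, of degree \<open>n - 2\<close>.\<close>
  define P where "P J = (\<Prod>j\<in>{..<n} - J. [:- u j, 1:])" for J
  have P: "poly (P J) t = (\<Prod>j\<in>{..<n} - J. t - u j)" for J t by (simp add: P_def poly_prod)
  have degP: "degree (P J) = card ({..<n} - J)" for J
    by (simp add: P_def degree_prod_eq_sum_degree)
  have leadP: "lead_coeff (P J) = 1" for J by (simp add: P_def lead_coeff_prod)
  have P1: "poly (P {j}) (l i) * (l i - u j) = lm i" if "j < n" for i j
    using that unfolding P lm_def by (subst (2) prod.remove[of _ j]) auto
  have P2: "poly (P {j, k}) (l i) * ((l i - u j) * (l i - u k)) = lm i" if "j < n" "k < n" "j \<noteq> k" for i j k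
  proof -
    have "lm i = (l i - u j) * (\<Prod>m\<in>{..<n} - {j}. l i - u m)"
      using that unfolding lm_def by (intro prod.remove) auto
    also have "(\<Prod>m\<in>{..<n} - {j}. l i - u m) = (l i - u k) * (\<Prod>m\<in>{..<n} - {j} - {k}. l i - u m)"
      using that by (intro prod.remove) auto
    also have "{..<n} - {j} - {k} = {..<n} - {j, k}" by auto
    finally show ?thesis by (simp add: P)
  qed
  \<comment> \<open>The squares of the entries of \<open>v\<close>; \<open>v2_1\<close> and \<open>v2_2\<close> bring them into Lagrange form.\<close>
  define v2 where "v2 i = - (lm i / lp i)" for i
  have v2_pos: "v2 i > 0" if i: "i < n" for i
  proof -
    have "lm i = (l i - u i) * (\<Prod>j\<in>{..<n} - {i}. l i - u j)"
      using that unfolding lm_def by (intro prod.remove) auto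
    then have "lm i / lp i = (l i - u i) * (\<Prod>j\<in>{..<n} - {i}. (l i - u j) / (l i - l j))"
      by (simp add: lp_def prod_dividef)
    then have "v2 i = (u i - l i) * (\<Prod>j\<in>{..<n} - {i}. (l i - u j) / (l i - l j))"
      unfolding v2_def by (simp only: minus_mult_left minus_diff_eq)
    moreover have "(l i - u j) / (l i - l j) > 0" if "j \<in> {..<n} - {i}" for j
    proof (cases "i < j")
      case True
      then show ?thesis using ll[of i j] lu[of j] that by (intro divide_neg_neg) auto
    next
      case False
      then show ?thesis using ul[of j i] ll[of j i] i that by (intro divide_pos_pos) auto
    qed
    ultimately show ?thesis using lu[OF i] by (auto intro!: mult_pos_pos prod_pos)
  qed
  have v2_1: "v2 i / (l i - u j) = - (poly (P {j}) (l i) / lp i)" if "i < n" "j < n" for i j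
    using P1[OF that(2), of i] lu_ne[OF that] by (simp add: v2_def divide_simps)
  have v2_2: "v2 i / ((l i - u j) * (l i - u k)) = - (poly (P {j, k}) (l i) / lp i)"
    if "i < n" "j < n" "k < n" "j \<noteq> k" for i j k
    using P2[OF that(2-4), of i] lu_ne[OF that(1,2)] lu_ne[OF that(1,3)] by (simp add: v2_def divide_simps)
  \<comment> \<open>The squared length of the eigenvector for \<open>u j\<close>, computed in \<open>sum2\<close>.\<close>
  define N2 where "N2 j = up j / um j" for j
  have sum1: "(\<Sum>i<n. v2 i / (l i - u j)) = - 1" if "j < n" for j
  proof -
    have deg: "degree (P {j}) = n - 1" using that by (simp add: degP)
    have "(\<Sum>i<n. v2 i / (l i - u j)) = - (\<Sum>i<n. poly (P {j}) (l i) / lp i)"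
      unfolding sum_negf[symmetric] using v2_1 that by (intro sum.cong) auto
    also have "(\<Sum>i<n. poly (P {j}) (l i) / lp i) = 1"
      using dd[of "P {j}"] leadP[of "{j}"] deg n by simp
    finally show ?thesis .
  qed
  have sum2: "(\<Sum>i<n. v2 i / ((l i - u j) * (l i - u k))) = (if j = k then N2 j else 0)"
    if "j < n" "k < n" for j k
  proof (cases "j = k")
    case True
    have deg: "degree (P {j}) < n" using that n by (simp add: degP)
    have "(\<Sum>i<n. v2 i / ((l i - u j) * (l i - u k))) = - (\<Sum>i<n. poly (P {j}) (l i) / lp i / (l i - u j))"
      unfolding sum_negf[symmetric] True[symmetric]
    proof (rule sum.cong[OF refl])
      fix i assume "i \<in> {..<n}"
      then show "v2 i / ((l i - u j) * (l i - u j)) = - (poly (P {j}) (l i) / lp i / (l i - u j))"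
        using v2_1[of i j] that by (simp flip: divide_divide_eq_left)
    qed
    also have "\<dots> = poly (P {j}) (u j) / um j" using pf[OF deg that(1)] by simp
    finally show ?thesis using True by (simp add: N2_def up_def P)
  next
    case False
    then have card: "card ({..<n} - {j, k}) < n - 1"
      using that by (subst card_Diff_subset) auto
    have "(\<Sum>i<n. v2 i / ((l i - u j) * (l i - u k))) = - (\<Sum>i<n. poly (P {j, k}) (l i) / lp i)"
      unfolding sum_negf[symmetric] using v2_2 that False by (intro sum.cong) auto
    also have "(\<Sum>i<n. poly (P {j, k}) (l i) / lp i) = 0"
      using dd[of "P {j, k}"] card by (simp add: degP coeff_eq_0)
    finally show ?thesis using False by simp
  qed
  have N2_pos: "N2 j > 0" if "j < n" for j
  proof -
    have "0 < (\<Sum>i<n. v2 i / ((l i - u j) * (l i - u j)))"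
    proof (rule sum_pos)
      fix i assume "i \<in> {..<n}"
      then have "0 < (l i - u j) * (l i - u j)"
        using lu_ne[of i j] that by (simp flip: power2_eq_square)
      then show "0 < v2 i / ((l i - u j) * (l i - u j))"
        using v2_pos \<open>i \<in> _\<close> by (intro divide_pos_pos) auto
    qed (use n in auto)
    then show ?thesis using sum2[OF that that] by simp
  qed
  define v where "v i = sqrt (v2 i)" for i
  have v: "v i * v i = v2 i" "v i \<noteq> 0" if "i < n" for i using v2_pos[OF that] by (simp_all add: v_def)
  define s where "s j = sqrt (N2 j)" for j
  have s: "s j * s j = N2 j" "s j \<noteq> 0" if "j < n" for j using N2_pos[OF that] by (simp_all add: s_def)
  define r where "r i j = v i / (l i - u j) / s j" for i j
  define U where "U = Matrix.mat n n (\<lambda>(i, j). complex_of_real (r i j))"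
  have U: "U \<in> carrier_mat n n" by (simp add: U_def)
  have orth: "(\<Sum>i<n. r i j * r i k) = (if j = k then 1 else 0)" if "j < n" "k < n" for j k
  proof -
    have "(\<Sum>i<n. r i j * r i k) = (\<Sum>i<n. v2 i / ((l i - u j) * (l i - u k)) / (s j * s k))"
      by (intro sum.cong refl) (simp add: r_def flip: v(1))
    also have "\<dots> = (if j = k then N2 j else 0) / (s j * s k)"
      unfolding sum_divide_distrib[symmetric] sum2[OF that] ..
    also have "\<dots> = (if j = k then 1 else 0)" using s[OF that(1)] by auto
    finally show ?thesis .
  qed
  have uU: "unitary_mat n U"
  proof (rule unitary_matI[OF U], rule eq_matI)
    fix j k assume "j < dim_row (1\<^sub>m n :: complex mat)" "k < dim_col (1\<^sub>m n :: complex mat)"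
    then have jk: "j < n" "k < n" by auto
    then have "(mat_adjoint U * U) $$ (j, k) = of_real (\<Sum>i<n. r i j * r i k)"
      using U by (simp add: scalar_prod_def atLeast0LessThan U_def)
    then show "(mat_adjoint U * U) $$ (j, k) = 1\<^sub>m n $$ (j, k)" using orth[OF jk] jk by simp
  qed (use U in auto)
  define H where "H = Matrix.mat n n (\<lambda>(i, k). complex_of_real ((if i = k then l i else 0) + v i * v k))"
  have H: "H \<in> carrier_mat n n" by (simp add: H_def)
  \<comment> \<open>Since \<open>U\<close> is unitary, checking that its columns are eigenvectors identifies \<open>H\<close>.\<close>
  have "H * U = U * mat_diag n (\<lambda>i. complex_of_real (u i))"
  proof (rule eq_matI)
    fix k j assume "k < dim_row (U * mat_diag n (\<lambda>i. complex_of_real (u i)))"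
      "j < dim_col (U * mat_diag n (\<lambda>i. complex_of_real (u i)))"
    then have kj: "k < n" "j < n" using U by (auto simp: mat_diag_def)
    have "(H * U) $$ (k, j) = of_real (\<Sum>i<n. ((if k = i then l k else 0) + v k * v i) * r i j)"
      using kj by (simp add: H_def U_def scalar_prod_def atLeast0LessThan)
    also have "(\<Sum>i<n. ((if k = i then l k else 0) + v k * v i) * r i j)
        = l k * r k j + v k * (\<Sum>i<n. v i * r i j)"
      using kj by (simp add: distrib_right sum.distrib mult_delta_left sum_distrib_left mult.assoc)
    also have "(\<Sum>i<n. v i * r i j) = (\<Sum>i<n. v2 i / (l i - u j)) / s j"
      unfolding sum_divide_distrib by (intro sum.cong refl) (simp add: r_def flip: v(1))
    also have "\<dots> = - (1 / s j)" unfolding sum1[OF kj(2)] by simp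
    also have "l k * r k j + v k * - (1 / s j) = r k j * u j"
    proof -
      have "(l k - u j) * r k j = v k / s j" using lu_ne[OF kj] by (simp add: r_def)
      then show ?thesis by (simp add: algebra_simps)
    qed
    finally show "(H * U) $$ (k, j) = (U * mat_diag n (\<lambda>i. complex_of_real (u i))) $$ (k, j)"
      using kj by (simp add: mat_diag_mult_right[OF U]) (simp add: U_def)
  qed (use H U in \<open>auto simp: mat_diag_def\<close>)
  then have "spectral_mat n U u = H * U * mat_adjoint U" by (simp add: spectral_mat_def)
  also have "\<dots> = H"
    using H unitary_matD[OF uU] by (simp add: assoc_mult_mat[of _ n n _ n _ n])
  finally have specU: "spectral_mat n U u = H" .
  have one: "unitary_mat n (1\<^sub>m n)" by (rule unitary_matI) auto
  have le: "loewner_le n (spectral_mat n (1\<^sub>m n) l) (spectral_mat n U u)"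
  proof (rule loewner_leI)
    show "hermitian_mat n (spectral_mat n (1\<^sub>m n) l)" "hermitian_mat n (spectral_mat n U u)"
      using U by (simp_all add: hermitian_spectral_mat)
    fix x :: "complex Matrix.vec" assume x: "x \<in> carrier_vec n"
    define g where "g = (\<Sum>k<n. of_real (v k) * x $ k)"
    have "(H *\<^sub>v x) $ i = of_real (l i) * x $ i + of_real (v i) * g" if "i < n" for i
    proof -
      have "(H *\<^sub>v x) $ i = (\<Sum>k<n. of_real ((if i = k then l i else 0) + v i * v k) * x $ k)"
        using that x by (simp add: H_def scalar_prod_def atLeast0LessThan)
      also have "\<dots> = (\<Sum>k<n. (if i = k then of_real (l i) * x $ i else 0) + of_real (v i) * (of_real (v k) * x $ k))"
        by (intro sum.cong) (auto simp: algebra_simps)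
      also have "\<dots> = of_real (l i) * x $ i + of_real (v i) * g"
        using that by (simp add: sum.distrib g_def sum_distrib_left)
      finally show ?thesis .
    qed
    then have "(H *\<^sub>v x) \<bullet>c x = (\<Sum>i<n. (of_real (l i) * x $ i + of_real (v i) * g) * cnj (x $ i))"
      using x by (simp add: scalar_prod_def atLeast0LessThan del: index_mult_mat_vec)
    also have "\<dots> = (\<Sum>i<n. of_real (l i) * (x $ i * cnj (x $ i))) + g * cnj g"
    proof -
      have "cnj g = (\<Sum>k<n. of_real (v k) * cnj (x $ k))" by (simp add: g_def)
      then show ?thesis by (simp add: distrib_left distrib_right sum.distrib sum_distrib_left ac_simps)
    qed
    also have "(\<Sum>i<n. of_real (l i) * (x $ i * cnj (x $ i))) = (spectral_mat n (1\<^sub>m n) l *\<^sub>v x) \<bullet>c x"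
      using spectral_mat_form[OF one_carrier_mat x x, of l] x by (simp add: mult.assoc)
    finally show "(spectral_mat n (1\<^sub>m n) l *\<^sub>v x) \<bullet>c x \<le> (spectral_mat n U u *\<^sub>v x) \<bullet>c x"
      unfolding specU complex_norm_square[symmetric] by (simp add: less_eq_complex_def)
  qed
  have "\<exists>w \<in> carrier_vec n.
      (\<forall>i<n. (cmod (w $ i))\<^sup>2 = - ((poly q (l i))\<^sup>2 / (lp i * lm i))) \<and>
      (\<forall>j<n. (cmod ((mat_adjoint U *\<^sub>v w) $ j))\<^sup>2 = (poly q (u j))\<^sup>2 / (um j * up j))"
    if q: "degree q \<le> n - 1" for q :: "real poly"
  proof -
    define h where "h i = poly q (l i) / (lp i * v i)" for i
    define w where "w = Matrix.vec n (\<lambda>i. complex_of_real (h i))"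
    have "(cmod (w $ i))\<^sup>2 = - ((poly q (l i))\<^sup>2 / (lp i * lm i))" if i: "i < n" for i
    proof -
      have "(cmod (w $ i))\<^sup>2 = (poly q (l i))\<^sup>2 / ((lp i)\<^sup>2 * v2 i)"
      proof -
        have "(cmod (w $ i))\<^sup>2 = (h i)\<^sup>2" using i by (simp add: w_def)
        then show ?thesis
          using v(1)[OF i] by (simp add: h_def power_divide power_mult_distrib power2_eq_square)
      qed
      also have "(lp i)\<^sup>2 * v2 i = - (lp i * lm i)"
        using nz(1)[OF i] by (simp add: v2_def power2_eq_square)
      finally show ?thesis by simp
    qed
    moreover have "(cmod ((mat_adjoint U *\<^sub>v w) $ j))\<^sup>2 = (poly q (u j))\<^sup>2 / (um j * up j)" if j: "j < n" for j
    proof -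
      have "(mat_adjoint U *\<^sub>v w) $ j = of_real (\<Sum>i<n. r i j * h i)"
        using U j by (simp add: scalar_prod_def atLeast0LessThan w_def U_def)
      also have "(\<Sum>i<n. r i j * h i) = (\<Sum>i<n. poly q (l i) / lp i / (l i - u j)) / s j"
        unfolding sum_divide_distrib using v(2) by (intro sum.cong refl) (simp add: r_def h_def)
      also have "\<dots> = - (poly q (u j) / um j) / s j"
        using pf[of q j] q n j by simp
      finally have "(cmod ((mat_adjoint U *\<^sub>v w) $ j))\<^sup>2 = (- (poly q (u j) / um j) / s j)\<^sup>2"
        by (simp only: norm_of_real power2_abs)
      also have "\<dots> = (poly q (u j))\<^sup>2 / ((um j)\<^sup>2 * (s j * s j))"
        by (simp add: power_divide power2_eq_square)
      also have "(um j)\<^sup>2 * (s j * s j) = um j * up j"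
        using s(1)[OF j] nz(4)[OF j] by (simp add: N2_def power2_eq_square)
      finally show ?thesis .
    qed
    ultimately show ?thesis by (intro bexI[of _ w]) (auto simp: w_def)
  qed
  with uU le show ?thesis using that by blast
qed

section \<open>The characterization\<close>

lemma div_diff_interlacing:
  fixes l u :: "nat \<Rightarrow> real"
  assumes l: "inj_on l {..<n}" and u: "inj_on u {..<n}" and disj: "l ` {..<n} \<inter> u ` {..<n} = {}"
  shows "div_diff (l ` {..<n} \<union> u ` {..<n}) g
    = (\<Sum>i<n. g (l i) / ((\<Prod>k\<in>{..<n} - {i}. l i - l k) * (\<Prod>j<n. l i - u j)))
    + (\<Sum>j<n. g (u j) / ((\<Prod>k<n. u j - l k) * (\<Prod>k\<in>{..<n} - {j}. u j - u k)))"
proof -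
  let ?L = "l ` {..<n}" and ?M = "u ` {..<n}"
  have diff: "x ` {..<n} - {x i} = x ` ({..<n} - {i})" and inj: "inj_on x ({..<n} - {i})"
    if "inj_on x {..<n}" "i < n" for x :: "nat \<Rightarrow> real" and i
    using inj_on_image_set_diff[OF that(1), of "{..<n}" "{i}"] that by (auto intro: inj_on_subset)
  have pl: "(\<Prod>y\<in>?L \<union> ?M - {l i}. l i - y) = (\<Prod>k\<in>{..<n} - {i}. l i - l k) * (\<Prod>j<n. l i - u j)"
    if "i < n" for i
  proof -
    have "?L \<union> ?M - {l i} = l ` ({..<n} - {i}) \<union> ?M"
      using disj that unfolding diff[OF l that, symmetric] by auto
    moreover have "l ` ({..<n} - {i}) \<inter> ?M = {}" using disj by auto
    ultimately show ?thesis
      by (simp add: prod.union_disjoint prod.reindex[OF inj[OF l that]] prod.reindex[OF u])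
  qed
  have pu: "(\<Prod>y\<in>?L \<union> ?M - {u j}. u j - y) = (\<Prod>k<n. u j - l k) * (\<Prod>k\<in>{..<n} - {j}. u j - u k)"
    if "j < n" for j
  proof -
    have "?L \<union> ?M - {u j} = ?L \<union> u ` ({..<n} - {j})"
      using disj that unfolding diff[OF u that, symmetric] by auto
    moreover have "?L \<inter> u ` ({..<n} - {j}) = {}" using disj by auto
    ultimately show ?thesis
      by (simp add: prod.union_disjoint prod.reindex[OF inj[OF u that]] prod.reindex[OF l])
  qed
  show ?thesis
    unfolding div_diff_def sum.union_disjoint[OF finite_imageI[OF finite_lessThan] finite_imageI[OF finite_lessThan] disj]
      sum.reindex[OF l] sum.reindex[OF u]
    by (intro arg_cong2[of _ _ _ _ "(+)"] sum.cong refl) (simp_all add: pl pu)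
qed

text \<open>Sort the points and use those of even rank as eigenvalues of \<open>A\<close> and those of odd rank as
  eigenvalues of \<open>B\<close>.\<close>
theorem n_monotone_imp_square_positive:
  assumes n: "n \<ge> 1" and mono: "n_monotone n a b f"
  shows "square_positive n (einterval a b) f"
  unfolding square_positive_def
proof (intro allI impI)
  fix X :: "real set" and q :: "real poly"
  assume X: "finite X" "X \<subseteq> einterval a b" "card X = 2 * n" and q: "degree q \<le> n - 1"
  define x where "x i = sorted_list_of_set X ! i" for i
  have x_less: "x i < x j" if "i < j" "j < 2 * n" for i j
    using sorted_wrt_nth_less[OF strict_sorted_list_of_set[of X], of i j] that X by (simp add: x_def)
  have x_X: "X = x ` {..<2 * n}"
  proof -
    have "X = set (sorted_list_of_set X)" using X by simp
    also have "\<dots> = x ` {..<2 * n}" using X by (auto simp: set_conv_nth x_def)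
    finally show ?thesis .
  qed
  define l u where "l i = x (2 * i)" and "u i = x (2 * i + 1)" for i
  have lu: "l i < u i" if "i < n" for i using that by (simp add: l_def u_def x_less)
  have ul: "u i < l j" if "i < j" "j < n" for i j using that by (simp add: l_def u_def x_less)
  have x_inj: "inj_on x {..<2 * n}"
    by (rule linorder_inj_onI') (use x_less in force)
  have ll: "l i < l j" and uu: "u i < u j" if "i < j" "j < n" for i j
    using that by (simp_all add: l_def u_def x_less)
  have l_inj: "inj_on l {..<n}" and u_inj: "inj_on u {..<n}"
    by (rule linorder_inj_onI'; use ll uu in force)+
  have disj: "l ` {..<n} \<inter> u ` {..<n} = {}"
  proof -
    have "l i \<noteq> u j" if "i < n" "j < n" for i j
      using inj_onD[OF x_inj, of "2 * i" "2 * j + 1"] that unfolding l_def u_def by (auto, presburger)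
    then show ?thesis by auto
  qed
  have X_eq: "X = l ` {..<n} \<union> u ` {..<n}"
  proof -
    have "x k \<in> l ` {..<n} \<union> u ` {..<n}" if "k < 2 * n" for k
    proof (cases "even k")
      case True
      then show ?thesis using that by (auto simp: l_def elim!: evenE)
    next
      case False
      then show ?thesis using that by (auto simp: u_def elim!: oddE)
    qed
    moreover have "l ` {..<n} \<union> u ` {..<n} \<subseteq> x ` {..<2 * n}" by (auto simp: l_def u_def)
    ultimately show ?thesis unfolding x_X by blast
  qed
  have "n > 0" using n by simp
  obtain U where U: "unitary_mat n U"
    and le: "loewner_le n (spectral_mat n (1\<^sub>m n) l) (spectral_mat n U u)"
    and ex: "\<And>q :: real poly. degree q \<le> n - 1 \<Longrightarrow> \<exists>w \<in> carrier_vec n.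
      (\<forall>i<n. (cmod (w $ i))\<^sup>2
        = - ((poly q (l i))\<^sup>2 / ((\<Prod>k\<in>{..<n} - {i}. l i - l k) * (\<Prod>j<n. l i - u j)))) \<and>
      (\<forall>j<n. (cmod ((mat_adjoint U *\<^sub>v w) $ j))\<^sup>2
        = (poly q (u j))\<^sup>2 / ((\<Prod>k<n. u j - l k) * (\<Prod>k\<in>{..<n} - {j}. u j - u k)))"
    by (rule interlacing_rank_one[OF \<open>n > 0\<close> lu ul]; (assumption | (rule that; assumption)))
  from ex[OF q] obtain w where w: "w \<in> carrier_vec n"
    and wl: "\<And>i. i < n \<Longrightarrow> (cmod (w $ i))\<^sup>2
      = - ((poly q (l i))\<^sup>2 / ((\<Prod>k\<in>{..<n} - {i}. l i - l k) * (\<Prod>j<n. l i - u j)))"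
    and wu: "\<And>j. j < n \<Longrightarrow> (cmod ((mat_adjoint U *\<^sub>v w) $ j))\<^sup>2
      = (poly q (u j))\<^sup>2 / ((\<Prod>k<n. u j - l k) * (\<Prod>k\<in>{..<n} - {j}. u j - u k))"
    by blast
  have one: "unitary_mat n (1\<^sub>m n)" by (rule unitary_matI) auto
  note u' = unitary_matD(1)[OF U] and one' = unitary_matD(1)[OF one]
  have sub: "l ` {..<n} \<subseteq> einterval a b" "u ` {..<n} \<subseteq> einterval a b" using X(2) X_eq by auto
  have "loewner_le n (fun_calc n f (spectral_mat n (1\<^sub>m n) l)) (fun_calc n f (spectral_mat n U u))"
    using mono[unfolded n_monotone_def, rule_format, OF hermitian_spectral_mat[OF one'] hermitian_spectral_mat[OF u'] _ _ le]
      sub by (simp add: spectrum_subset_iff[OF one] spectrum_subset_iff[OF U])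
  then have "(spectral_mat n (1\<^sub>m n) (\<lambda>i. f (l i)) *\<^sub>v w) \<bullet>c w \<le> (spectral_mat n U (\<lambda>i. f (u i)) *\<^sub>v w) \<bullet>c w"
    unfolding fun_calc_spectral_mat[OF one] fun_calc_spectral_mat[OF U] using w by (rule loewner_leD)
  then have "(\<Sum>i<n. f (l i) * (cmod (w $ i))\<^sup>2) \<le> (\<Sum>j<n. f (u j) * (cmod ((mat_adjoint U *\<^sub>v w) $ j))\<^sup>2)"
    unfolding spectral_mat_form_self[OF one' w] spectral_mat_form_self[OF u' w]
    using w by (simp add: less_eq_complex_def)
  also have "\<dots> = (\<Sum>j<n. f (u j) * (poly q (u j))\<^sup>2 / ((\<Prod>k<n. u j - l k) * (\<Prod>k\<in>{..<n} - {j}. u j - u k)))"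
    using wu by (intro sum.cong) auto
  also have "(\<Sum>i<n. f (l i) * (cmod (w $ i))\<^sup>2)
      = - (\<Sum>i<n. f (l i) * (poly q (l i))\<^sup>2 / ((\<Prod>k\<in>{..<n} - {i}. l i - l k) * (\<Prod>j<n. l i - u j)))"
    unfolding sum_negf[symmetric] using wl by (intro sum.cong) auto
  finally show "0 \<le> div_diff X (\<lambda>t. f t * (poly q t)\<^sup>2)"
    unfolding X_eq div_diff_interlacing[OF l_inj u_inj disj] by simp
qed

lemma square_positive_iff_divided_difference:
  assumes "n \<ge> 1"
  shows "square_positive n I f \<longleftrightarrow>
    (\<forall>(q :: real poly) (x :: nat \<Rightarrow> real).
       degree q \<le> n - 1 \<longrightarrow> inj_on x {..2 * n - 1} \<longrightarrow> x ` {..2 * n - 1} \<subseteq> I \<longrightarrow>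
       0 \<le> divided_difference (2 * n - 1) x (\<lambda>t. f t * (poly q t)\<^sup>2))"
proof (intro iffI allI impI)
  fix q :: "real poly" and x :: "nat \<Rightarrow> real"
  assume f: "square_positive n I f" and q: "degree q \<le> n - 1"
    and x: "inj_on x {..2 * n - 1}" "x ` {..2 * n - 1} \<subseteq> I"
  have "card (x ` {..2 * n - 1}) = 2 * n" using card_image[OF x(1)] assms by simp
  then show "0 \<le> divided_difference (2 * n - 1) x (\<lambda>t. f t * (poly q t)\<^sup>2)"
    unfolding divided_difference_eq_div_diff[OF x(1)] by (intro square_positiveD[OF f] x(2) q) auto
next
  assume R: "\<forall>(q :: real poly) (x :: nat \<Rightarrow> real).
       degree q \<le> n - 1 \<longrightarrow> inj_on x {..2 * n - 1} \<longrightarrow> x ` {..2 * n - 1} \<subseteq> I \<longrightarrow>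
       0 \<le> divided_difference (2 * n - 1) x (\<lambda>t. f t * (poly q t)\<^sup>2)"
  show "square_positive n I f"
    unfolding square_positive_def
  proof (intro allI impI)
    fix X :: "real set" and q :: "real poly"
    assume X: "finite X" "X \<subseteq> I" "card X = 2 * n" and q: "degree q \<le> n - 1"
    have "{..2 * n - 1} = {0..<2 * n}" using assms by auto
    then obtain x where "bij_betw x {..2 * n - 1} X"
      using ex_bij_betw_nat_finite[OF X(1)] X(3) by auto
    then have x: "inj_on x {..2 * n - 1}" "x ` {..2 * n - 1} = X" by (auto simp: bij_betw_def)
    then have "0 \<le> divided_difference (2 * n - 1) x (\<lambda>t. f t * (poly q t)\<^sup>2)"
      using R q X(2) by simp
    then show "0 \<le> div_diff X (\<lambda>t. f t * (poly q t)\<^sup>2)"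
      unfolding divided_difference_eq_div_diff[OF x(1)] x(2) .
  qed
qed

theorem theorem1p3:
  fixes n :: nat and a b :: ereal and f :: "real \<Rightarrow> real"
  assumes "n \<ge> 1" and "a < b"
  shows "n_monotone n a b f \<longleftrightarrow>
    (\<forall>(q :: real poly) (x :: nat \<Rightarrow> real).
       degree q \<le> n - 1 \<longrightarrow> inj_on x {..2 * n - 1} \<longrightarrow> x ` {..2 * n - 1} \<subseteq> einterval a b \<longrightarrow>
       0 \<le> divided_difference (2 * n - 1) x (\<lambda>t. f t * (poly q t)\<^sup>2))"
  unfolding square_positive_iff_divided_difference[OF assms(1), symmetric]
  using n_monotone_imp_square_positive[OF assms(1)] square_positive_imp_n_monotone[OF assms(2)] by blast

end
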